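(* Suppose $f_{\mathbb{Q}}\in\mathbb{Q}[x_1,\dots,x_n]$ is homogeneous under some $\mathbb{N}$-grading with an isolated singularity at the origin, and write the rational number $\operatorname{lct}(f_{\mathbb{Q}})=\frac ab$ in lowest terms. Then for all primes $p\gg 0$, either $\operatorname{fpt}(f_p)=\operatorname{lct}(f_{\mathbb{Q}})$, or $$\frac{b^{-1}}{p^{\operatorname{ord}(p,b)}}\le \operatorname{lct}(f_{\mathbb{Q}})-\operatorname{fpt}(f_p)\le \frac{n-1-b^{-1}}{p}.$$ Moreover, these bounds are sharp: there exist an integer $n\ge 1$ and a polynomial $f_{\mathbb{Q}}\in\mathbb{Q}[x_1,\dots,x_n]$, homogeneous under some $\mathbb{N}$-grading with an isolated singularity at the origin and with $\operatorname{lct}(f_{\mathbb{Q}})=\frac ab$ in lowest terms, for which the lower bound is an equality, i.e. $\operatorname{lct}(f_{\mathbb{Q}})-\operatorname{fpt}(f_p)=\frac{b^{-1}}{p^{\operatorname{ord}(p,b)}}$, for infinitely many primes $p$; and there exist an integer $n\ge 1$ and a polynomial $f_{\mathbb{Q}}\in\mathbb{Q}[x_1,\dots,x_n]$, homogeneous under some $\mathbb{N}$-grading with an isolated singularity at the origin and with $\operatorname{lct}(f_{\mathbb{Q}})=\frac ab$ in lowest terms, for which the upper bound is an equality, i.e. $\operatorname{lct}(f_{\mathbb{Q}})-\operatorname{fpt}(f_p)=\frac{n-1-b^{-1}}{p}$, for infinitely many primes $p$ (in both cases with $\operatorname{fpt}(f_p)\neq\operatorname{lct}(f_{\mathbb 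Q})$).
   Context: An $\mathbb{N}$-grading on a polynomial ring over a field is a grading in which field elements have degree $0$ and each variable has a positive integer degree. For a nonzero homogeneous $f_{\mathbb{Q}}$, having an isolated singularity at the origin means $\sqrt{\operatorname{Jac}(f_{\mathbb{Q}})}=(x_1,\dots,x_n)$, where $\operatorname{Jac}$ is the ideal generated by the partial derivatives. For $p\gg0$, $f_p\in\mathbb{F}_p[x_1,\dots,x_n]$ is the polynomial obtained by reducing the coefficients of $f_{\mathbb{Q}}$ modulo $p$. In characteristic $p$, with $\mathfrak{m}=(x_1,\dots,x_n)$, $\mathfrak{m}^{[p^e]}=(x_1^{p^e},\dots,x_n^{p^e})$ and $f\in\mathfrak{m}$, set $\nu_f(p^e)=\max\{N: f^N\notin\mathfrak{m}^{[p^e]}\}$ and $\operatorname{fpt}(f)=\lim_{e\to\infty}\nu_f(p^e)/p^e$ (the limit exists). The log canonical threshold is taken to be $\operatorname{lct}(f_{\mathbb{Q}})=\lim_{p\to\infty}\operatorname{fpt}(f_p)$; it is known that this limit exists, is a rational number in $(0,1]$, agrees with the usual log canonical threshold at the origin, and that $\operatorname{fpt}(f_p)\le\operatorname{lct}(f_{\mathbb{Q}})$ for $p\gg0$. For $p\nmid b$, $\operatorname{ord}(p,b)$ is the least integer $k\ge1$ with $p^k\equiv1\bmod b$ (so $\operatorname{ord}(p,1)=1$). *)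

theory Defs
  imports
    Complex_Main
    "HOL-Library.Multiset"
    "HOL-Algebra.Indexed_Polynomials"
    "HOL-Algebra.Algebraic_Closure_Type"
    "HOL-Number_Theory.Number_Theory"
begin

text \<open>
  Polynomials in the variables \<open>x\<^sub>0, \<dots>, x\<^sub>n\<^sub>-\<^sub>1\<close> over a ring \<open>R\<close>. As in
  \<^theory>\<open>HOL-Algebra.Indexed_Polynomials\<close>, a polynomial is its coefficient function and a monomial
  is a multiset of variables: \<open>count m i\<close> is the exponent of \<open>x\<^sub>i\<close> in \<open>m\<close>. That theory provides
  the carrier, the constants, the sum and the variables; only the (convolution) product is added.
\<close>

definition mpoly_ring :: "('a, 'b) ring_scheme \<Rightarrow> nat \<Rightarrow> (nat multiset \<Rightarrow> 'a) ring" where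
  "mpoly_ring R n =
     \<lparr> carrier = ring.indexed_pset R {..<n} (carrier R),
       monoid.mult = (\<lambda>f g m. \<Oplus>\<^bsub>R\<^esub>u \<in> {u. u \<subseteq># m}. f u \<otimes>\<^bsub>R\<^esub> g (m - u)),
       one = ring.indexed_const R \<one>\<^bsub>R\<^esub>,
       ring.zero = ring.indexed_const R \<zero>\<^bsub>R\<^esub>,
       ring.add = ring.indexed_padd R \<rparr>"

lemma finite_submultisets: "finite {u. u \<subseteq># (m::'c multiset)}"
proof (induction m)
  case (add x m)
  have "{u. u \<subseteq># add_mset x m} \<subseteq> {u. u \<subseteq># m} \<union> add_mset x ` {u. u \<subseteq># m}"
  proof
    fix u assume u: "u \<in> {u. u \<subseteq># add_mset x m}"
    show "u \<in> {u. u \<subseteq># m} \<union> add_mset x ` {u. u \<subseteq># m}"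
    proof (cases "x \<in># u")
      case True
      then obtain v where "u = add_mset x v" by (meson multi_member_split)
      with u show ?thesis by auto
    next
      case False
      then have "u \<subseteq># m" using u unfolding subseteq_mset_def mem_Collect_eq
        by (metis count_add_mset le0 not_in_iff)
      then show ?thesis by simp
    qed
  qed
  with add show ?case by (meson finite_UnI finite_imageI finite_subset)
qed simp

context ring begin

lemma monom_in_pset:
  assumes "set_mset m \<subseteq> I" "k \<in> carrier R"
  shows "(\<lambda>m'. if m' = m then k else \<zero>) \<in> indexed_pset I (carrier R)"
  using assms(1)
proof (induction m)
  case empty
  show ?case using indexed_const[OF assms(2), of I] by (simp add: indexed_const_def)
next
  case (add x m)
  have "(\<lambda>m'. if m' = m then k else \<zero>) \<Otimes> x \<in> indexed_pset I (carrier R)"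
    using add by (intro indexed_pmult) auto
  moreover have "(\<lambda>m'. if m' = m then k else \<zero>) \<Otimes> x = (\<lambda>m'. if m' = add_mset x m then k else \<zero>)"
    by (auto simp: indexed_pmult_def fun_eq_iff dest: multi_member_split)
  ultimately show ?case by simp
qed

lemma indexed_pset_iff:
  fixes P :: "'c multiset \<Rightarrow> 'a"
  shows "P \<in> indexed_pset I (carrier R) \<longleftrightarrow>
     carrier_coeff P \<and> finite {m. P m \<noteq> \<zero>} \<and> (\<forall>m. P m \<noteq> \<zero> \<longrightarrow> set_mset m \<subseteq> I)"
  (is "?L \<longleftrightarrow> ?R")
proof
  assume ?L
  then show ?R
  proof induction
    case (indexed_const k)
    have "{m. local.indexed_const k m \<noteq> \<zero>} \<subseteq> {{#}}" by (auto simp: indexed_const_def)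
    then show ?case using indexed_const
      by (auto simp: indexed_const_def carrier_coeff_def intro: finite_subset)
  next
    case (indexed_padd P Q)
    have "{m. local.indexed_padd P Q m \<noteq> \<zero>} \<subseteq> {m. P m \<noteq> \<zero>} \<union> {m. Q m \<noteq> \<zero>}"
      using indexed_padd by (auto simp: indexed_padd_def carrier_coeff_def)
    moreover have "\<forall>m. local.indexed_padd P Q m \<noteq> \<zero> \<longrightarrow> set_mset m \<subseteq> I"
      using calculation indexed_padd.IH by blast
    ultimately show ?case using indexed_padd
      by (auto intro: finite_subset indexed_padd_in_carrier)
  next
    case (indexed_pmult P i)
    have sub: "{m. local.indexed_pmult P i m \<noteq> \<zero>} \<subseteq> add_mset i ` {m. P m \<noteq> \<zero>}"
      by (auto simp: indexed_pmult_def image_iff split: if_splits dest!: multi_member_split)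
    have "finite {m. local.indexed_pmult P i m \<noteq> \<zero>}"
      using indexed_pmult.IH by (intro finite_subset[OF sub]) auto
    moreover have "set_mset m \<subseteq> I" if nz: "local.indexed_pmult P i m \<noteq> \<zero>" for m
    proof -
      obtain m' where "m = add_mset i m'" "P m' \<noteq> \<zero>"
        using subsetD[OF sub, of m] nz by blast
      then show ?thesis
        using indexed_pmult.IH indexed_pmult.hyps by simp
    qed
    moreover have "carrier_coeff (local.indexed_pmult P i)"
      using indexed_pmult.IH by (intro indexed_pmult_in_carrier) simp
    ultimately show ?case by simp
  qed
next
  assume R: ?R
  have "finite S \<Longrightarrow> \<forall>P. carrier_coeff P \<and> {m. P m \<noteq> \<zero>} = S \<and> (\<forall>m. P m \<noteq> \<zero> \<longrightarrow> set_mset m \<subseteq> I)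
     \<longrightarrow> P \<in> indexed_pset I (carrier R)" for S :: "'c multiset set"
  proof (induction S rule: finite_induct)
    case empty
    have "P = local.indexed_const \<zero>" if "{m. P m \<noteq> \<zero>} = {}" for P :: "'c multiset \<Rightarrow> 'a"
      using that by (auto simp: indexed_const_def fun_eq_iff)
    then show ?case using indexed_pset.indexed_const[of \<zero> "carrier R" I] by auto
  next
    case (insert m S)
    show ?case
    proof (intro allI impI)
      fix P assume P: "carrier_coeff P \<and> {m. P m \<noteq> \<zero>} = insert m S \<and> (\<forall>m. P m \<noteq> \<zero> \<longrightarrow> set_mset m \<subseteq> I)"
      have "{m'. (P(m := \<zero>)) m' \<noteq> \<zero>} = {m'. P m' \<noteq> \<zero>} - {m}"
        by auto
      then have "{m'. (P(m := \<zero>)) m' \<noteq> \<zero>} = S"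
        using P insert.hyps by simp
      then have "P(m := \<zero>) \<in> indexed_pset I (carrier R)"
        using insert.IH P by (simp add: carrier_coeff_def)
      moreover have "(\<lambda>m'. if m' = m then P m else \<zero>) \<in> indexed_pset I (carrier R)"
        using P by (intro monom_in_pset) (auto simp: carrier_coeff_def)
      ultimately have "P(m := \<zero>) \<Oplus> (\<lambda>m'. if m' = m then P m else \<zero>) \<in> indexed_pset I (carrier R)"
        by (rule indexed_pset.indexed_padd)
      moreover have "P(m := \<zero>) \<Oplus> (\<lambda>m'. if m' = m then P m else \<zero>) = P"
        using P by (auto simp: fun_eq_iff indexed_padd_def carrier_coeff_def)
      ultimately show "P \<in> indexed_pset I (carrier R)" by simp
    qed
  qed
  with R show ?L by blast
qed

end

lemma (in abelian_monoid) finsum_swap_dep: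
  assumes "finite A" "\<And>a. a \<in> A \<Longrightarrow> finite (B a)" "\<And>a b. a \<in> A \<Longrightarrow> b \<in> B a \<Longrightarrow> f a b \<in> carrier G"
  shows "(\<Oplus>a\<in>A. \<Oplus>b\<in>B a. f a b) = (\<Oplus>x\<in>Sigma A B. f (fst x) (snd x))"
proof -
  have "(\<Oplus>x\<in>Sigma A B. f (fst x) (snd x)) = (\<Oplus>x\<in>(\<Union>a\<in>A. Pair a ` B a). f (fst x) (snd x))"
    by (rule arg_cong[where f="\<lambda>S. finsum G _ S"]) auto
  also have "\<dots> = (\<Oplus>a\<in>A. \<Oplus>x\<in>Pair a ` B a. f (fst x) (snd x))"
    using assms by (intro add.finprod_UN_disjoint) (auto simp: pairwise_def disjnt_def)
  also have "\<dots> = (\<Oplus>a\<in>A. \<Oplus>b\<in>B a. f a b)"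
  proof (intro finsum_cong' refl)
    fix a assume a: "a \<in> A"
    have "(\<Oplus>x\<in>Pair a ` B a. f (fst x) (snd x)) = (\<Oplus>b\<in>B a. f (fst (a, b)) (snd (a, b)))"
      using a assms by (intro finsum_reindex) (auto simp: inj_on_def)
    then show "(\<Oplus>x\<in>Pair a ` B a. f (fst x) (snd x)) = (\<Oplus>b\<in>B a. f a b)" by simp
  qed (use assms in \<open>auto intro!: finsum_closed\<close>)
  finally show ?thesis by simp
qed

lemma (in cring) cring_mpoly_ring: "cring (mpoly_ring R n)"
proof -
  let ?M = "mpoly_ring R n"
  let ?S = "\<lambda>m::nat multiset. {u. u \<subseteq># m}"
  note [simp] = finite_submultisets
  have dd: "m - (m - u) = u" if "u \<subseteq># m" for m u :: "nat multiset"
    using that by (intro multiset_eqI) (simp add: subseteq_mset_def)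
  have dd2: "m - v - (u - v) = m - u" if "v \<subseteq># u" for m u v :: "nat multiset"
    using that by (intro multiset_eqI) (simp add: subseteq_mset_def)
  have car: "f \<in> carrier ?M \<longleftrightarrow> carrier_coeff f \<and> finite {m. f m \<noteq> \<zero>} \<and> (\<forall>m. f m \<noteq> \<zero> \<longrightarrow> set_mset m \<subseteq> {..<n})" for f
    unfolding mpoly_ring_def by (simp add: indexed_pset_iff)
  have cf[simp]: "f \<in> carrier ?M \<Longrightarrow> f m \<in> carrier R" for f m by (simp add: car carrier_coeff_def)
  have mul: "(f \<otimes>\<^bsub>?M\<^esub> g) m = (\<Oplus>u\<in>?S m. f u \<otimes> g (m-u))" for f g m by (simp add: mpoly_ring_def)
  have addd: "(f \<oplus>\<^bsub>?M\<^esub> g) m = f m \<oplus> g m" for f g m by (simp add: mpoly_ring_def indexed_padd_def)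
  have mulc: "f \<otimes>\<^bsub>?M\<^esub> g \<in> carrier ?M" if f: "f \<in> carrier ?M" and g: "g \<in> carrier ?M" for f g
  proof -
    have 0: "\<exists>u. u \<subseteq># m \<and> f u \<noteq> \<zero> \<and> g (m-u) \<noteq> \<zero>" if "(f \<otimes>\<^bsub>?M\<^esub> g) m \<noteq> \<zero>" for m
    proof (rule ccontr)
      assume "\<not> ?thesis"
      then have "f u \<otimes> g (m-u) = \<zero>" if "u \<in> ?S m" for u using that f g by (metis cf l_null r_null mem_Collect_eq)
      then have "(\<Oplus>u\<in>?S m. f u \<otimes> g (m-u)) = \<zero>" by (intro add.finprod_one_eqI) auto
      then show False using that by (simp add: mul)
    qed
    have sub: "{m. (f \<otimes>\<^bsub>?M\<^esub> g) m \<noteq> \<zero>} \<subseteq> (\<lambda>(u,v). u+v) ` ({m. f m \<noteq> \<zero>} \<times> {m. g m \<noteq> \<zero>})"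
      using 0 by (force simp: image_iff)
    have "set_mset m \<subseteq> {..<n}" if mm: "(f \<otimes>\<^bsub>?M\<^esub> g) m \<noteq> \<zero>" for m
    proof -
      obtain u where "u \<subseteq># m" "f u \<noteq> \<zero>" "g (m - u) \<noteq> \<zero>" using 0[OF mm] by blast
      then obtain u v where "m = u + v" "f u \<noteq> \<zero>" "g v \<noteq> \<zero>" by (metis subset_mset.add_diff_inverse)
      then show ?thesis using f g unfolding car by (metis Un_least set_mset_union)
    qed
    moreover have "finite {m. (f \<otimes>\<^bsub>?M\<^esub> g) m \<noteq> \<zero>}"
      using f g unfolding car by (intro finite_subset[OF sub]) auto
    ultimately show ?thesis
      using f g unfolding car carrier_coeff_def by (auto simp: mul intro!: finsum_closed)
  qed
  have comm: "f \<otimes>\<^bsub>?M\<^esub> g = g \<otimes>\<^bsub>?M\<^esub> f" if f: "f \<in> carrier ?M" and g: "g \<in> carrier ?M" for f g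
  proof
    fix m
    have im: "(\<lambda>u. m - u) ` ?S m = ?S m"
      by (auto simp: image_iff) (metis dd diff_subset_eq_self)
    have inj: "inj_on (\<lambda>u. m - u) (?S m)"
      by (rule inj_onI) (metis mem_Collect_eq dd)
    have "(g \<otimes>\<^bsub>?M\<^esub> f) m = (\<Oplus>u\<in>(\<lambda>u. m - u) ` ?S m. g u \<otimes> f (m-u))" by (simp add: mul im)
    also have "\<dots> = (\<Oplus>u\<in>?S m. g (m-u) \<otimes> f (m-(m-u)))"
      using f g by (intro finsum_reindex inj) auto
    also have "\<dots> = (\<Oplus>u\<in>?S m. f u \<otimes> g (m-u))"
      using f g by (intro finsum_cong' refl) (auto simp: dd m_comm)
    finally show "(f \<otimes>\<^bsub>?M\<^esub> g) m = (g \<otimes>\<^bsub>?M\<^esub> f) m" by (simp add: mul)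
  qed
  have assoc: "(f \<otimes>\<^bsub>?M\<^esub> g) \<otimes>\<^bsub>?M\<^esub> h = f \<otimes>\<^bsub>?M\<^esub> (g \<otimes>\<^bsub>?M\<^esub> h)"
    if f: "f \<in> carrier ?M" and g: "g \<in> carrier ?M" and h: "h \<in> carrier ?M" for f g h
  proof
    fix m
    let ?A = "Sigma (?S m) ?S" and ?B = "Sigma (?S m) (\<lambda>v. ?S (m - v))"
    let ?F = "\<lambda>u v. f v \<otimes> g (u - v) \<otimes> h (m - u)"
    let ?G = "\<lambda>v w. f v \<otimes> (g w \<otimes> h (m - v - w))"
    have im: "(\<lambda>(u,v). (v, u - v)) ` ?A = ?B"
    proof (intro equalityI subsetI)
      fix x assume "x \<in> (\<lambda>(u,v). (v, u - v)) ` ?A"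
      then obtain u v where x: "x = (v, u - v)" "v \<subseteq># u" "u \<subseteq># m" by auto
      have "v \<subseteq># m" "u - v \<subseteq># m - v" using x by (auto simp: subseteq_mset_def intro: diff_le_mono le_trans)
      then show "x \<in> ?B" using x by auto
    next
      fix x assume "x \<in> ?B"
      then obtain v w where x: "x = (v,w)" "v \<subseteq># m" "w \<subseteq># m - v" by auto
      then have "v + w \<subseteq># m" by (metis mset_subset_eq_mono_add_left_cancel subset_mset.add_diff_inverse)
      then show "x \<in> (\<lambda>(u,v). (v, u - v)) ` ?A" using x by (intro image_eqI[of _ _ "(v+w, v)"]) auto
    qed
    have inj: "inj_on (\<lambda>(u,v). (v, u - v)) ?A"
      by (auto simp: inj_on_def) (metis subset_mset.diff_add)
    have "((f \<otimes>\<^bsub>?M\<^esub> g) \<otimes>\<^bsub>?M\<^esub> h) m = (\<Oplus>u\<in>?S m. \<Oplus>v\<in>?S u. ?F u v)"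
      unfolding mul using f g h by (intro finsum_cong' refl) (auto simp: finsum_ldistr Pi_def intro!: finsum_closed)
    also have "\<dots> = (\<Oplus>x\<in>?A. ?F (fst x) (snd x))" using f g h by (intro finsum_swap_dep) auto
    also have "\<dots> = (\<Oplus>x\<in>?A. (\<lambda>y. ?G (fst y) (snd y)) ((\<lambda>(u,v). (v, u - v)) x))"
      using f g h by (intro finsum_cong' refl) (auto simp: m_assoc dd2)
    also have "\<dots> = (\<Oplus>y\<in>(\<lambda>(u,v). (v, u - v)) ` ?A. ?G (fst y) (snd y))"
      using f g h by (intro finsum_reindex[symmetric] inj) auto
    also have "\<dots> = (\<Oplus>y\<in>?B. ?G (fst y) (snd y))" by (simp only: im)
    also have "\<dots> = (\<Oplus>v\<in>?S m. \<Oplus>w\<in>?S (m-v). ?G v w)" using f g h by (intro finsum_swap_dep[symmetric]) auto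
    also have "\<dots> = (f \<otimes>\<^bsub>?M\<^esub> (g \<otimes>\<^bsub>?M\<^esub> h)) m"
      unfolding mul using f g h by (intro finsum_cong' refl) (auto simp: finsum_rdistr Pi_def intro!: finsum_closed)
    finally show "((f \<otimes>\<^bsub>?M\<^esub> g) \<otimes>\<^bsub>?M\<^esub> h) m = (f \<otimes>\<^bsub>?M\<^esub> (g \<otimes>\<^bsub>?M\<^esub> h)) m" .
  qed
  have onec: "\<one>\<^bsub>?M\<^esub> \<in> carrier ?M" and zeroc: "\<zero>\<^bsub>?M\<^esub> \<in> carrier ?M"
    by (auto simp: mpoly_ring_def intro!: indexed_pset.indexed_const)
  have addc: "f \<oplus>\<^bsub>?M\<^esub> g \<in> carrier ?M" if "f \<in> carrier ?M" "g \<in> carrier ?M" for f g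
    using that by (auto simp: mpoly_ring_def intro!: indexed_pset.indexed_padd)
  have oneM: "\<one>\<^bsub>?M\<^esub> m = (if m = {#} then \<one> else \<zero>)" and zeroM: "\<zero>\<^bsub>?M\<^esub> m = \<zero>" for m
    by (auto simp: mpoly_ring_def indexed_const_def)
  have negc: "(\<lambda>m. \<ominus> f m) \<in> carrier ?M" if f: "f \<in> carrier ?M" for f
  proof -
    have "{m. \<ominus> f m \<noteq> \<zero>} \<subseteq> {m. f m \<noteq> \<zero>}" by auto
    then show ?thesis using f unfolding car carrier_coeff_def by (auto intro: finite_subset)
  qed
  show ?thesis
  proof (rule cringI)
    show "abelian_group ?M"
    proof (rule abelian_groupI)
      fix f assume f: "f \<in> carrier ?M"
      show "\<exists>g\<in>carrier ?M. g \<oplus>\<^bsub>?M\<^esub> f = \<zero>\<^bsub>?M\<^esub>"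
        using f negc[OF f] by (intro bexI[of _ "\<lambda>m. \<ominus> f m"]) (auto simp: fun_eq_iff addd zeroM l_neg)
    qed (auto simp: addc zeroc fun_eq_iff addd zeroM a_assoc intro: a_comm)
    show "comm_monoid ?M"
    proof (rule comm_monoidI)
      fix f assume f: "f \<in> carrier ?M"
      show "\<one>\<^bsub>?M\<^esub> \<otimes>\<^bsub>?M\<^esub> f = f"
      proof
        fix m
        have "(\<one>\<^bsub>?M\<^esub> \<otimes>\<^bsub>?M\<^esub> f) m = (\<Oplus>u\<in>?S m. if {#} = u then f (m - u) else \<zero>)"
          unfolding mul oneM using f by (intro finsum_cong' refl) auto
        also have "\<dots> = f (m - {#})" using f by (intro add.finprod_singleton) auto
        finally show "(\<one>\<^bsub>?M\<^esub> \<otimes>\<^bsub>?M\<^esub> f) m = f m" by simp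
      qed
    qed (auto simp: mulc onec assoc intro: comm)
    fix f g h assume fgh: "f \<in> carrier ?M" "g \<in> carrier ?M" "h \<in> carrier ?M"
    show "(f \<oplus>\<^bsub>?M\<^esub> g) \<otimes>\<^bsub>?M\<^esub> h = f \<otimes>\<^bsub>?M\<^esub> h \<oplus>\<^bsub>?M\<^esub> g \<otimes>\<^bsub>?M\<^esub> h"
    proof
      fix m
      show "((f \<oplus>\<^bsub>?M\<^esub> g) \<otimes>\<^bsub>?M\<^esub> h) m = (f \<otimes>\<^bsub>?M\<^esub> h \<oplus>\<^bsub>?M\<^esub> g \<otimes>\<^bsub>?M\<^esub> h) m"
        unfolding addd mul using fgh
        by (subst finsum_addf[symmetric]) (auto simp: l_distr addd intro!: finsum_cong')
    qed
  qed
qed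

definition mpoly_deriv :: "('a, 'b) ring_scheme \<Rightarrow> nat \<Rightarrow> (nat multiset \<Rightarrow> 'a) \<Rightarrow> (nat multiset \<Rightarrow> 'a)" where
  "mpoly_deriv R i f = (\<lambda>m. [Suc (count m i)] \<cdot>\<^bsub>R\<^esub> f (add_mset i m))"

definition jacobian_ideal :: "('a, 'b) ring_scheme \<Rightarrow> nat \<Rightarrow> (nat multiset \<Rightarrow> 'a) \<Rightarrow> (nat multiset \<Rightarrow> 'a) set" where
  "jacobian_ideal R n f = Idl\<^bsub>mpoly_ring R n\<^esub> ((\<lambda>i. mpoly_deriv R i f) ` {..<n})"

definition ideal_radical :: "('a, 'b) ring_scheme \<Rightarrow> 'a set \<Rightarrow> 'a set" where
  "ideal_radical A I = {x \<in> carrier A. \<exists>k::nat. x [^]\<^bsub>A\<^esub> k \<in> I}"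

text \<open>The ideal \<open>(x\<^sub>0\<^sup>q, \<dots>, x\<^sub>n\<^sub>-\<^sub>1\<^sup>q)\<close>; for \<open>q = 1\<close> this is the homogeneous maximal ideal.\<close>

definition var_power_ideal :: "('a, 'b) ring_scheme \<Rightarrow> nat \<Rightarrow> nat \<Rightarrow> (nat multiset \<Rightarrow> 'a) set" where
  "var_power_ideal R n q =
     Idl\<^bsub>mpoly_ring R n\<^esub> ((\<lambda>i. ring.indexed_var R i [^]\<^bsub>mpoly_ring R n\<^esub> q) ` {..<n})"

definition maximal_ideal_origin :: "('a, 'b) ring_scheme \<Rightarrow> nat \<Rightarrow> (nat multiset \<Rightarrow> 'a) set" where
  "maximal_ideal_origin R n = Idl\<^bsub>mpoly_ring R n\<^esub> (ring.indexed_var R ` {..<n})"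

definition homogeneous_some_grading :: "('a, 'b) ring_scheme \<Rightarrow> nat \<Rightarrow> (nat multiset \<Rightarrow> 'a) \<Rightarrow> bool" where
  "homogeneous_some_grading R n f \<longleftrightarrow>
     (\<exists>w :: nat \<Rightarrow> nat. (\<forall>i<n. 0 < w i) \<and>
       (\<exists>d. \<forall>m. f m \<noteq> \<zero>\<^bsub>R\<^esub> \<longrightarrow> (\<Sum>i<n. w i * count m i) = d))"

definition isolated_singularity_origin :: "('a, 'b) ring_scheme \<Rightarrow> nat \<Rightarrow> (nat multiset \<Rightarrow> 'a) \<Rightarrow> bool" where
  "isolated_singularity_origin R n f \<longleftrightarrow>
     ideal_radical (mpoly_ring R n) (jacobian_ideal R n f) = maximal_ideal_origin R n"

abbreviation QQ :: "rat ring" where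
  "QQ \<equiv> ring_of_type_algebra"

abbreviation FF :: "nat \<Rightarrow> int ring" where
  "FF p \<equiv> residue_ring (int p)"

definition homogeneous_isolated :: "nat \<Rightarrow> (nat multiset \<Rightarrow> rat) \<Rightarrow> bool" where
  "homogeneous_isolated n f \<longleftrightarrow>
     f \<in> carrier (mpoly_ring QQ n) \<and> f \<noteq> \<zero>\<^bsub>mpoly_ring QQ n\<^esub> \<and>
     homogeneous_some_grading QQ n f \<and> isolated_singularity_origin QQ n f"

text \<open>
  Reduction modulo \<open>p\<close>. It is meaningful when \<open>p\<close> does not divide the denominator (otherwise the
  inverse of \<open>0\<close> is taken); for a given polynomial this excludes only finitely many \<open>p\<close>.
\<close>

definition rat_mod :: "nat \<Rightarrow> rat \<Rightarrow> int" where
  "rat_mod p r = (case quotient_of r of (a, b) \<Rightarrow> (a mod int p) \<otimes>\<^bsub>FF p\<^esub> inv\<^bsub>FF p\<^esub> (b mod int p))"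

definition reduce_mod :: "nat \<Rightarrow> (nat multiset \<Rightarrow> rat) \<Rightarrow> (nat multiset \<Rightarrow> int)" where
  "reduce_mod p f = (\<lambda>m. rat_mod p (f m))"

definition frob_nu :: "nat \<Rightarrow> nat \<Rightarrow> (nat multiset \<Rightarrow> int) \<Rightarrow> nat \<Rightarrow> nat" where
  "frob_nu n p f e = Max {N. f [^]\<^bsub>mpoly_ring (FF p) n\<^esub> N \<notin> var_power_ideal (FF p) n (p ^ e)}"

definition fpt :: "nat \<Rightarrow> nat \<Rightarrow> (nat multiset \<Rightarrow> int) \<Rightarrow> real" where
  "fpt n p f = lim (\<lambda>e. real (frob_nu n p f e) / real (p ^ e))"

text \<open>
  The log canonical threshold is taken to be the limit of the F-pure thresholds \<open>fpt (f\<^sub>p)\<close> along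
  the primes; it is known to agree with the usual log canonical threshold at the origin.
\<close>

definition lct :: "nat \<Rightarrow> (nat multiset \<Rightarrow> rat) \<Rightarrow> real" where
  "lct n f = Lim (inf at_top (principal {p. Factorial_Ring.prime p})) (\<lambda>p. fpt n p (reduce_mod p f))"

end

theory Submission
  imports Defs "HOL-Library.Poly_Mapping"
begin

text \<open>
  Let \<open>f\<close> have degree \<open>d\<close> for the weights \<open>w\<close>, put \<open>\<mu> = (\<Sum>i. w i) / d\<close> and \<open>\<lambda> = min \<mu> 1\<close>, and for a large prime \<open>p\<close> let
  \<open>\<nu>(e)\<close> be the largest \<open>N\<close> with \<open>f\<^sub>p\<^sup>N\<close> outside the Frobenius power \<open>\<mm>\<^bsup>[p^e]\<^esup>\<close> of the maximal ideal. The numbers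
  \<open>(\<nu>(e) + 1) / p\<^sup>e\<close> start at \<open>1\<close>, never increase and converge to the threshold; for \<open>e > 0\<close> they drop
  at \<open>e\<close> exactly when \<open>p\<close> does not divide \<open>\<nu>(e) + 1\<close>.

  The geometry enters through drops. Put \<open>q = p\<^sup>e\<close>. Since \<open>\<mm>\<^bsup>[q]\<^esup>\<close> is stable under derivations, differentiating
  \<open>f\<^bsup>N+1\<^esup> \<in> \<mm>\<^bsup>[q]\<^esup>\<close> with \<open>N = \<nu>(e)\<close> shows, when \<open>N + 1\<close> is a unit, that \<open>f\<^sup>N\<close> multiplies the Jacobian ideal into
  \<open>\<mm>\<^bsup>[q]\<^esup>\<close> without lying in \<open>\<mm>\<^bsup>[q]\<^esup>\<close> itself. The partial derivatives are a homogeneous system of parameters, and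
  such a multiplier cannot have small degree: \<open>N d \<ge> q \<Sum>w - \<Sum>(d - w j)\<close>, that is \<open>\<nu>(e) \<ge> (q + 1) \<mu> - n\<close>. The
  usual proof computes the socle degree of a graded complete intersection. In characteristic \<open>p\<close> there
  is a shorter way, taken in the lemma \<open>degree_of_colon_element\<close>: raise everything to the \<open>Q\<close>-th power
  for \<open>Q\<close> a large power of \<open>p\<close>. A monomial of degree above \<open>C + (Q - 1) \<Sum>(d - w j)\<close>, with \<open>C\<close> independent of \<open>Q\<close>,
  lies in the ideal of the \<open>Q\<close>-th powers of the parameters, and comparing the terms linear in \<open>Q\<close> gives
  the sharp bound.

  The rest is arithmetic of the sequence \<open>\<nu>\<close> (locale \<open>nu_sequence\<close>). Infinitely many drops force the
  threshold up to \<open>\<mu>\<close>, so if it differs from \<open>\<lambda>\<close>, there is a last drop \<open>L\<close> and the threshold equals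
  \<open>(\<nu>(L) + 1) / p\<^sup>L\<close>. The degree bound at \<open>L\<close> then yields \<open>\<lambda> - fpt \<le> (n - 1 - \<lambda>) / p\<^sup>L\<close>, hence the upper bound; and
  with \<open>\<lambda> = a/b\<close> the difference is a positive multiple of \<open>1 / (b p\<^sup>L)\<close>. The lower bound follows once \<open>L\<close> is
  at most \<open>k = ord b p\<close>. If \<open>L\<close> were larger, the threshold would be so close to \<open>\<lambda>\<close> that the integer
  \<open>\<lambda> (p\<^sup>k - 1)\<close> is at most \<open>\<nu>(k)\<close>, and the superadditivity \<open>\<nu>(e + e') \<ge> p\<^sup>e \<nu>(e') + \<nu>(e)\<close> would propagate this to
  all multiples of \<open>k\<close> and give \<open>fpt \<ge> \<lambda>\<close>. The upper bound also shows that the thresholds converge to \<open>\<lambda>\<close>,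
  so \<open>\<lambda>\<close> is the log canonical threshold.

  For the sharpness of both bounds one example suffices: \<open>x\<^sup>4 + y\<^sup>4\<close> has \<open>\<lambda> = 1/2\<close>, so for odd \<open>p\<close> both bounds
  are \<open>1 / (2 p)\<close>, and the threshold is smaller than \<open>1/2\<close> when \<open>p \<equiv> 3\<close> modulo \<open>4\<close>.

  All computations take place in \<open>\<int>[x]\<close> modulo \<open>p\<close>, with one integral multiple of \<open>f\<close> serving all large primes.
\<close>

section \<open>Polynomials with finitely supported coefficients\<close>

text \<open>
  Finitely supported maps from monomials to coefficients form a commutative ring in the sense of type
  classes, which makes ring calculations automatic. The set of variables is not bounded here; a bound
  on the variables is imposed only where degrees are counted.
\<close>

type_synonym 'a mpoly = "nat multiset \<Rightarrow>\<^sub>0 'a"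

abbreviation mcoeff :: "'a::zero mpoly \<Rightarrow> nat multiset \<Rightarrow> 'a" where
  "mcoeff \<equiv> Poly_Mapping.lookup"

abbreviation mterm :: "nat multiset \<Rightarrow> 'a::zero \<Rightarrow> 'a mpoly" where
  "mterm \<equiv> Poly_Mapping.single"

lemma mcoeff_mult:
  fixes P Q :: "'a::comm_ring_1 mpoly"
  shows "mcoeff (P * Q) m = (\<Sum>u | u \<subseteq># m. mcoeff P u * mcoeff Q (m - u))"
proof -
  have *: "Sum_any (\<lambda>q. mcoeff Q q when m = l + q) = (if l \<subseteq># m then mcoeff Q (m - l) else 0)" for l
  proof (cases "l \<subseteq># m")
    case True
    then have "Sum_any (\<lambda>q. mcoeff Q q when m = l + q) = Sum_any (\<lambda>q. mcoeff Q q when q = m - l)"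
      by (intro Sum_any.cong) (auto simp: when_def)
    then show ?thesis using True by simp
  next
    case False
    then have "Sum_any (\<lambda>q. mcoeff Q q when m = l + q) = Sum_any (\<lambda>q::nat multiset. 0 :: 'a)"
      by (intro Sum_any.cong) (auto simp: when_def)
    then show ?thesis using False by simp
  qed
  have "mcoeff (P * Q) m = Sum_any (\<lambda>l. mcoeff P l * (if l \<subseteq># m then mcoeff Q (m - l) else 0))"
    by (simp add: lookup_mult *)
  also have "\<dots> = (\<Sum>u | u \<subseteq># m. mcoeff P u * (if u \<subseteq># m then mcoeff Q (m - u) else 0))"
    by (rule Sum_any.expand_superset) (auto simp: finite_submultisets)
  finally show ?thesis by simp
qed

lemma mcoeff_term_mult:
  fixes P :: "'a::comm_ring_1 mpoly"
  shows "mcoeff (mterm u c * P) m = (if u \<subseteq># m then c * mcoeff P (m - u) else 0)"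
proof -
  have "mcoeff (mterm u c * P) m
      = (\<Sum>v | v \<subseteq># m. if u = v then c * mcoeff P (m - v) else 0)"
    unfolding mcoeff_mult by (intro sum.cong) (auto simp: lookup_single when_def)
  then show ?thesis by (simp add: finite_submultisets)
qed

lemma mcoeff_mult_nonzeroE:
  fixes P Q :: "'a::comm_ring_1 mpoly"
  assumes "mcoeff (P * Q) m \<noteq> 0"
  obtains u v where "m = u + v" "mcoeff P u \<noteq> 0" "mcoeff Q v \<noteq> 0"
proof -
  obtain u where "u \<subseteq># m" "mcoeff P u * mcoeff Q (m - u) \<noteq> 0"
    using assms unfolding mcoeff_mult by (elim sum.not_neutral_contains_not_neutral) auto
  then show ?thesis using that[of u "m - u"] by (auto dest: mult_not_zero)
qed

lemma mpoly_eq_sum_terms: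
  "(P :: 'a::comm_ring_1 mpoly) = (\<Sum>m\<in>Poly_Mapping.keys P. mterm m (mcoeff P m))"
proof (rule poly_mapping_eqI)
  fix k
  show "mcoeff P k = mcoeff (\<Sum>m\<in>Poly_Mapping.keys P. mterm m (mcoeff P m)) k"
    by (auto simp: lookup_sum lookup_single when_def in_keys_iff)
qed

lemma mcoeff_of_nat_mult: "mcoeff (of_nat k * P) m = of_nat k * mcoeff (P :: 'a::comm_ring_1 mpoly) m"
  by (simp add: mcoeff_term_mult flip: single_of_nat)

lemma of_nat_dvd_mcoeff:
  "of_nat k dvd (P :: int mpoly) \<Longrightarrow> int k dvd mcoeff P m"
  by (auto simp: dvd_def mcoeff_of_nat_mult)

section \<open>Frobenius powers of the ideal of the origin\<close>

text \<open>
  Monomials outside the ideal generated by the \<open>q\<close>-th powers of all variables.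
\<close>

definition below :: "nat \<Rightarrow> nat multiset \<Rightarrow> bool" where
  "below q m \<longleftrightarrow> (\<forall>i. count m i < q)"

text \<open>
  The preimage in \<open>\<int>[x]\<close> of the Frobenius power \<open>\<mm>\<^bsup>[q]\<^esup>\<close> in \<open>F\<^sub>p[x]\<close>. As \<open>\<mm>\<^bsup>[q]\<^esup>\<close> is generated by monomials, membership
  is a condition on single coefficients.
\<close>

definition frob_ideal :: "nat \<Rightarrow> nat \<Rightarrow> int mpoly set" where
  "frob_ideal p q = {P. \<forall>m. below q m \<longrightarrow> int p dvd mcoeff P m}"

lemma below_subset: "below q m \<Longrightarrow> u \<subseteq># m \<Longrightarrow> below q u"
  unfolding below_def subseteq_mset_def by (meson le_less_trans)

lemma frob_ideal_mult: "P \<in> frob_ideal p q \<Longrightarrow> P * Q \<in> frob_ideal p q"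
  by (auto simp: frob_ideal_def mcoeff_mult intro!: dvd_sum intro: dvd_mult2 below_subset)

lemma frob_ideal_mult': "P \<in> frob_ideal p q \<Longrightarrow> Q * P \<in> frob_ideal p q"
  using frob_ideal_mult[of P p q Q] by (simp add: mult.commute)

lemma frob_ideal_sum: "(\<And>i. i \<in> A \<Longrightarrow> f i \<in> frob_ideal p q) \<Longrightarrow> sum f A \<in> frob_ideal p q"
  unfolding frob_ideal_def by (auto simp: lookup_sum intro!: dvd_sum)

lemma frob_ideal_cong:
  assumes "of_nat p dvd P - Q"
  shows "P \<in> frob_ideal p q \<longleftrightarrow> Q \<in> frob_ideal p q"
proof -
  have "int p dvd mcoeff P m \<longleftrightarrow> int p dvd mcoeff Q m" for m
    using of_nat_dvd_mcoeff[OF assms, of m] dvd_add_right_iff[of "int p" "mcoeff P m - mcoeff Q m" "mcoeff Q m"]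
    by (simp add: lookup_minus)
  then show ?thesis by (simp add: frob_ideal_def)
qed

text \<open>
  A polynomial with invertible constant term is a unit modulo the ideal, because the variables are
  nilpotent there. Concretely, a smallest monomial of \<open>u\<close> outside the ideal survives in \<open>u * v\<close>.
\<close>

lemma frob_ideal_cancel_unit:
  assumes "u * v \<in> frob_ideal p q" "prime p" "\<not> int p dvd mcoeff v {#}"
  shows "u \<in> frob_ideal p q"
proof (rule ccontr)
  assume "u \<notin> frob_ideal p q"
  then have "\<exists>m. below q m \<and> \<not> int p dvd mcoeff u m" by (auto simp: frob_ideal_def)
  then obtain m where m: "below q m" "\<not> int p dvd mcoeff u m"
    and min: "\<And>m'. size m' < size m \<Longrightarrow> below q m' \<Longrightarrow> int p dvd mcoeff u m'"
    using exists_least_iff[of "\<lambda>s. \<exists>m. size m = s \<and> below q m \<and> \<not> int p dvd mcoeff u m"] by blast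
  have "int p dvd mcoeff (u * v) m" using assms(1) m(1) by (auto simp: frob_ideal_def)
  moreover have "mcoeff (u * v) m
      = mcoeff u m * mcoeff v {#} + (\<Sum>x\<in>{x. x \<subseteq># m} - {m}. mcoeff u x * mcoeff v (m - x))"
    unfolding mcoeff_mult by (subst sum.remove[of _ m]) (auto simp: finite_submultisets)
  moreover have "int p dvd (\<Sum>x\<in>{x. x \<subseteq># m} - {m}. mcoeff u x * mcoeff v (m - x))"
  proof (intro dvd_sum dvd_mult2)
    fix x assume x: "x \<in> {x. x \<subseteq># m} - {m}"
    then have "size x < size m" by (auto intro!: mset_subset_size simp: subset_mset_def)
    then show "int p dvd mcoeff u x" using min x below_subset[OF m(1)] by auto
  qed
  ultimately have "int p dvd mcoeff u m * mcoeff v {#}" by (simp add: dvd_add_left_iff)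
  then show False using assms m prime_dvd_mult_iff[of "int p"] by auto
qed

section \<open>The Frobenius endomorphism modulo a prime\<close>

lemma dvd_diff_trans:
  fixes a x y z :: "'a::comm_ring_1"
  assumes "a dvd x - y" "a dvd y - z"
  shows "a dvd x - z"
  using dvd_add[OF assms] by simp

lemma freshman_dvd:
  fixes a b :: "'a::comm_ring_1"
  assumes "prime p"
  shows "of_nat p dvd (a + b) ^ p - (a ^ p + b ^ p)"
proof -
  have p: "p > 0" using assms prime_gt_0_nat by blast
  have "(a + b) ^ p = (\<Sum>k\<in>{..p}. of_nat (p choose k) * a ^ k * b ^ (p - k))"
    by (rule binomial_ring)
  also have "\<dots> = a ^ p + (b ^ p + (\<Sum>k\<in>{..p} - {p} - {0}. of_nat (p choose k) * a ^ k * b ^ (p - k)))"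
    using p by (subst sum.remove[of _ p], simp, simp, subst sum.remove[of _ 0]) auto
  finally have "(a + b) ^ p - (a ^ p + b ^ p)
      = (\<Sum>k\<in>{..p} - {p} - {0}. of_nat (p choose k) * a ^ k * b ^ (p - k))"
    by simp
  also have "of_nat p dvd \<dots>"
  proof (intro dvd_sum dvd_mult2)
    fix k assume "k \<in> {..p} - {p} - {0}"
    then have "p dvd p choose k" using assms p by (intro dvd_choose_prime) auto
    then show "(of_nat p :: 'a) dvd of_nat (p choose k)" by (metis dvd_def of_nat_mult)
  qed
  finally show ?thesis .
qed

lemma freshman_power_dvd:
  fixes a b :: "'a::comm_ring_1"
  assumes "prime p"
  shows "of_nat p dvd (a + b) ^ (p ^ e) - (a ^ (p ^ e) + b ^ (p ^ e))"
proof (induction e)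
  case (Suc e)
  let ?A = "a ^ (p ^ e)" and ?B = "b ^ (p ^ e)"
  have "of_nat p dvd ((a + b) ^ (p ^ e)) ^ p - (?A + ?B) ^ p"
    using Suc by (metis dvd_mult2 power_diff_sumr2)
  moreover have "of_nat p dvd (?A + ?B) ^ p - (?A ^ p + ?B ^ p)" by (rule freshman_dvd[OF assms])
  ultimately have "of_nat p dvd ((a + b) ^ (p ^ e)) ^ p - (?A ^ p + ?B ^ p)" by (rule dvd_diff_trans)
  then show ?case by (simp only: power_mult[symmetric] power_Suc2)
qed simp

lemma freshman_sum_dvd:
  fixes f :: "'b \<Rightarrow> 'a::comm_ring_1"
  assumes "prime p"
  shows "of_nat p dvd (sum f A) ^ (p ^ e) - (\<Sum>i\<in>A. f i ^ (p ^ e))"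
proof (induction A rule: infinite_finite_induct)
  case (insert x A)
  have "of_nat p dvd ((f x + sum f A) ^ (p ^ e) - (f x ^ (p ^ e) + sum f A ^ (p ^ e)))
      + (sum f A ^ (p ^ e) - (\<Sum>i\<in>A. f i ^ (p ^ e)))"
    by (intro dvd_add freshman_power_dvd assms insert.IH)
  then show ?case using insert.hyps by (simp add: algebra_simps)
qed (use assms prime_gt_0_nat in \<open>auto simp: zero_power\<close>)

text \<open>
  The freshman's dream with \<open>b = 1\<close> makes the claim for \<open>c\<close> and for \<open>c + 1\<close> equivalent, so it spreads from \<open>0\<close>
  to all integers in both directions.
\<close>

lemma fermat_power_dvd:
  assumes "prime p"
  shows "int p dvd c ^ (p ^ e) - c"
proof -
  have step: "int p dvd (c + 1) ^ (p ^ e) - (c + 1) \<longleftrightarrow> int p dvd c ^ (p ^ e) - c" for c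
  proof -
    have "int p dvd (c + 1) ^ (p ^ e) - (c ^ (p ^ e) + 1)"
      using freshman_power_dvd[OF assms, of c 1 e] by simp
    moreover have "(c + 1) ^ (p ^ e) - (c + 1)
        = ((c + 1) ^ (p ^ e) - (c ^ (p ^ e) + 1)) + (c ^ (p ^ e) - c)" by simp
    ultimately show ?thesis by (metis dvd_add_right_iff)
  qed
  show ?thesis
  proof (induction c rule: int_induct[of _ 0])
    case base
    show ?case using prime_gt_0_nat[OF assms] by (simp add: zero_power)
  next
    case (step1 i)
    then show ?case using step by blast
  next
    case (step2 i)
    then show ?case using step[of "i - 1"] by simp
  qed
qed

text \<open>\<open>subst_power q P\<close> is \<open>P(x\<^sub>0\<^sup>q, x\<^sub>1\<^sup>q, \<dots>)\<close>.\<close>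

definition subst_power :: "nat \<Rightarrow> int mpoly \<Rightarrow> int mpoly" where
  "subst_power q P = (\<Sum>m\<in>Poly_Mapping.keys P. mterm (repeat_mset q m) (mcoeff P m))"

lemma mterm_power: "mterm m c ^ k = mterm (repeat_mset k m) ((c::'a::comm_ring_1) ^ k)"
  by (induction k) (auto simp: mult_single)

lemma power_dvd_subst_power:
  assumes "prime p"
  shows "of_nat p dvd P ^ (p ^ e) - subst_power (p ^ e) P"
proof -
  have "of_nat p dvd P ^ (p ^ e) - (\<Sum>m\<in>Poly_Mapping.keys P. mterm m (mcoeff P m) ^ (p ^ e))"
    by (subst (1) mpoly_eq_sum_terms[of P]) (rule freshman_sum_dvd[OF assms])
  moreover have "of_nat p dvd (\<Sum>m\<in>Poly_Mapping.keys P. mterm m (mcoeff P m) ^ (p ^ e)) - subst_power (p ^ e) P"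
  proof -
    have "of_nat p dvd mterm m (c::int) ^ (p ^ e) - mterm (repeat_mset (p ^ e) m) c" for m c
    proof -
      obtain k where k: "c ^ (p ^ e) - c = int p * k" using fermat_power_dvd[OF assms] by (auto simp: dvd_def)
      have "mterm m c ^ (p ^ e) - mterm (repeat_mset (p ^ e) m) c = mterm (repeat_mset (p ^ e) m) (int p * k)"
        unfolding mterm_power k[symmetric] by (rule single_diff[symmetric])
      also have "\<dots> = of_nat p * mterm (repeat_mset (p ^ e) m) k"
        by (simp add: mult_single flip: single_of_nat)
      finally show ?thesis by simp
    qed
    then show ?thesis unfolding subst_power_def sum_subtractf[symmetric] by (intro dvd_sum)
  qed
  ultimately show ?thesis by (rule dvd_diff_trans)
qed

text \<open>
  Modulo \<open>p\<close>, every polynomial is uniquely \<open>\<Sum>b. x\<^sup>b P\<^sub>b(x\<^sup>q)\<close> over the \<open>b\<close> with all exponents below \<open>q\<close>; this is the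
  coordinate \<open>P\<^sub>b\<close>. It expresses the freeness of the polynomial ring over its \<open>q\<close>-th powers.
\<close>

definition slice :: "nat \<Rightarrow> nat multiset \<Rightarrow> int mpoly \<Rightarrow> int mpoly" where
  "slice q b P = Poly_Mapping.map_key (\<lambda>m. repeat_mset q m + b) P"

lemma mcoeff_slice:
  assumes "q > 0"
  shows "mcoeff (slice q b P) m = mcoeff P (repeat_mset q m + b)"
proof -
  have "inj (\<lambda>m. repeat_mset q m + b)" using assms by (auto simp: inj_def repeat_mset_cancel1)
  then show ?thesis unfolding slice_def by (simp add: map_key.rep_eq)
qed

lemma repeat_subset_iff_below:
  assumes "below q b" "q > 0"
  shows "repeat_mset q m \<subseteq># repeat_mset q g + b \<longleftrightarrow> m \<subseteq># g"
proof -
  have "q * x \<le> q * y + z \<longleftrightarrow> x \<le> y" if "z < q" for x y z :: nat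
  proof
    assume "q * x \<le> q * y + z"
    then have "q * x < q * (y + 1)" using that by simp
    then show "x \<le> y" using assms(2) by (metis Suc_eq_plus1 less_Suc_eq_le nat_mult_less_cancel1)
  qed (simp add: trans_le_add1)
  then show ?thesis using assms(1) by (simp add: subseteq_mset_def below_def)
qed

text \<open>
  Taking coordinates is linear over the \<open>q\<close>-th powers. Only terms need to be compared, and there
  the claim is that \<open>x\<^bsup>qm\<^esup>\<close> divides \<open>x\<^bsup>qg+b\<^esup>\<close> if and only if \<open>x\<^sup>m\<close> divides \<open>x\<^sup>g\<close>.
\<close>

lemma slice_subst_power_mult:
  assumes "below q b" "q > 0"
  shows "slice q b (subst_power q U * H) = U * slice q b H"
proof (rule poly_mapping_eqI)
  fix g
  have eq: "repeat_mset q g + b - repeat_mset q m = repeat_mset q (g - m) + b" if "m \<subseteq># g" for m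
    using that by (intro multiset_eqI) (simp add: subseteq_mset_def diff_mult_distrib2)
  have "mcoeff (slice q b (subst_power q U * H)) g
     = (\<Sum>m\<in>Poly_Mapping.keys U. mcoeff (mterm (repeat_mset q m) (mcoeff U m) * H) (repeat_mset q g + b))"
    by (simp add: mcoeff_slice assms subst_power_def sum_distrib_right lookup_sum)
  also have "\<dots> = (\<Sum>m\<in>Poly_Mapping.keys U. mcoeff (mterm m (mcoeff U m) * slice q b H) g)"
    by (intro sum.cong refl) (auto simp: mcoeff_term_mult repeat_subset_iff_below[OF assms] mcoeff_slice assms eq)
  also have "\<dots> = mcoeff ((\<Sum>m\<in>Poly_Mapping.keys U. mterm m (mcoeff U m)) * slice q b H) g"
    by (simp add: sum_distrib_right lookup_sum)
  finally show "mcoeff (slice q b (subst_power q U * H)) g = mcoeff (U * slice q b H) g"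
    by (simp flip: mpoly_eq_sum_terms)
qed

lemma below_repeat_add:
  assumes "below q b" "below q' m"
  shows "below (q * q') (repeat_mset q m + b)"
  unfolding below_def
proof
  fix i
  have "count m i < q'" "count b i < q" using assms by (auto simp: below_def)
  then have "q * count m i + count b i < q * (count m i + 1)" "q * (count m i + 1) \<le> q * q'"
    using mult_le_mono2[of "count m i + 1" q' q] by auto
  then show "count (repeat_mset q m + b) i < q * q'" by (simp only: count_repeat_mset count_union)
qed

lemma slice_in_frob_ideal:
  assumes "P \<in> frob_ideal p (q * q')" "below q b" "q > 0"
  shows "slice q b P \<in> frob_ideal p q'"
  using assms by (auto simp: frob_ideal_def mcoeff_slice below_repeat_add)

text \<open>
  This is the source of the superadditivity of \<open>\<nu>\<close>. Some coordinate of \<open>h\<close> has an invertible constant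
  term because \<open>h\<close> is outside the ideal; taking that coordinate of \<open>u\<^sup>q h\<close> leaves \<open>u\<close> times a unit.
\<close>

lemma frob_ideal_cancel_frobenius:
  assumes p: "prime p" and q: "q = p ^ e" and in_ideal: "u ^ q * h \<in> frob_ideal p (q * q')" and h: "h \<notin> frob_ideal p q"
  shows "u \<in> frob_ideal p q'"
proof -
  have q0: "q > 0" using p q prime_gt_0_nat by simp
  obtain b where b: "below q b" "\<not> int p dvd mcoeff h b" using h by (auto simp: frob_ideal_def)
  have "of_nat p dvd u ^ q * h - subst_power q u * h"
    using power_dvd_subst_power[OF p, of u e] unfolding q left_diff_distrib[symmetric] by (rule dvd_mult2)
  then have "subst_power q u * h \<in> frob_ideal p (q * q')" using in_ideal frob_ideal_cong by blast
  then have "u * slice q b h \<in> frob_ideal p q'"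
    using slice_in_frob_ideal[OF _ b(1) q0] slice_subst_power_mult[OF b(1) q0] by metis
  then show ?thesis using p b(2) q0 by (intro frob_ideal_cancel_unit[of u "slice q b h"]) (auto simp: mcoeff_slice)
qed

lemma one_notin_frob_ideal: "prime p \<Longrightarrow> q > 0 \<Longrightarrow> 1 \<notin> frob_ideal p q"
  using prime_gt_1_nat[of p] by (auto simp: frob_ideal_def below_def lookup_one intro!: exI[of _ "{#}"])

lemma frob_ideal_power_iff:
  assumes p: "prime p" and q: "q = p ^ e"
  shows "u ^ q \<in> frob_ideal p (q * q') \<longleftrightarrow> u \<in> frob_ideal p q'"
proof
  have q0: "q > 0" using p q prime_gt_0_nat by simp
  assume "u ^ q \<in> frob_ideal p (q * q')"
  then show "u \<in> frob_ideal p q'"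
    using frob_ideal_cancel_frobenius[OF p q, of u 1 q'] one_notin_frob_ideal[OF p q0] by simp
next
  have q0: "q > 0" using p q prime_gt_0_nat by simp
  assume u: "u \<in> frob_ideal p q'"
  have "subst_power q u \<in> frob_ideal p (q * q')"
    unfolding subst_power_def frob_ideal_def
  proof (intro CollectI allI impI)
    fix m assume m: "below (q * q') m"
    have "int p dvd mcoeff (mterm (repeat_mset q k) (mcoeff u k)) m" for k
    proof (cases "m = repeat_mset q k")
      case True
      then have "below q' k" using m q0 by (auto simp: below_def)
      then show ?thesis using u True by (auto simp: frob_ideal_def)
    qed (auto simp: lookup_single when_def)
    then show "int p dvd mcoeff (\<Sum>k\<in>Poly_Mapping.keys u. mterm (repeat_mset q k) (mcoeff u k)) m"
      by (auto simp: lookup_sum intro!: dvd_sum)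
  qed
  then show "u ^ q \<in> frob_ideal p (q * q')"
    using power_dvd_subst_power[OF p, of u e] frob_ideal_cong unfolding q by blast
qed

section \<open>Weighted degrees\<close>

definition wdeg :: "(nat \<Rightarrow> nat) \<Rightarrow> nat multiset \<Rightarrow> nat" where
  "wdeg w m = (\<Sum>i\<in>#m. w i)"

lemma wdeg_add [simp]: "wdeg w (m + m') = wdeg w m + wdeg w m'"
  by (simp add: wdeg_def)

lemma wdeg_empty [simp]: "wdeg w {#} = 0"
  by (simp add: wdeg_def)

lemma wdeg_add_mset [simp]: "wdeg w (add_mset i m) = w i + wdeg w m"
  by (simp add: wdeg_def)

lemma wdeg_replicate [simp]: "wdeg w (replicate_mset k i) = k * w i"
  by (induction k) auto

lemma wdeg_repeat [simp]: "wdeg w (repeat_mset k m) = k * wdeg w m"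
  by (induction k) auto

lemma wdeg_eq_sum: "set_mset m \<subseteq> {..<n} \<Longrightarrow> wdeg w m = (\<Sum>i<n. w i * count m i)"
proof (induction m)
  case (add x m)
  have "(\<Sum>i<n. w i * count (add_mset x m) i) = (\<Sum>i<n. w i * count m i + (if i = x then w x else 0))"
    by (intro sum.cong) auto
  also have "\<dots> = (\<Sum>i<n. w i * count m i) + w x" using add.prems by (simp add: sum.distrib)
  finally show ?case using add by simp
qed simp

lemma wdeg_le_if_counts_below:
  assumes "set_mset m \<subseteq> {..<n}" "\<And>i. i < n \<Longrightarrow> count m i < k"
  shows "wdeg w m \<le> (k - 1) * (\<Sum>i<n. w i)"
  unfolding wdeg_eq_sum[OF assms(1)] sum_distrib_left
proof (intro sum_mono)
  fix i assume "i \<in> {..<n}"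
  then have "count m i \<le> k - 1" using assms(2)[of i] by simp
  then show "w i * count m i \<le> (k - 1) * w i" by (simp add: mult.commute mult_le_mono1)
qed

text \<open>
  The largest monomial in \<open>n\<close> variables with all exponents below \<open>s\<close>. It spans the socle of
  the quotient by the \<open>s\<close>-th powers of the variables.
\<close>

definition top_monom :: "nat \<Rightarrow> nat \<Rightarrow> nat multiset" where
  "top_monom n s = (\<Sum>i<n. replicate_mset (s - 1) i)"

lemma count_top_monom: "count (top_monom n s) i = (if i < n then s - 1 else 0)"
  by (simp add: top_monom_def count_sum)

lemma set_top_monom: "set_mset (top_monom n s) \<subseteq> {..<n}"
  by (metis count_top_monom lessThan_iff not_in_iff subsetI)

lemma wdeg_top_monom: "wdeg w (top_monom n s) = (s - 1) * (\<Sum>i<n. w i)"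
  by (simp add: wdeg_eq_sum[OF set_top_monom] count_top_monom sum_distrib_left mult.commute)

definition hom_poly :: "nat \<Rightarrow> (nat \<Rightarrow> nat) \<Rightarrow> nat \<Rightarrow> 'a::zero mpoly \<Rightarrow> bool" where
  "hom_poly n w d P \<longleftrightarrow> (\<forall>m. mcoeff P m \<noteq> 0 \<longrightarrow> set_mset m \<subseteq> {..<n} \<and> wdeg w m = d)"

lemma hom_poly_mult:
  fixes P Q :: "'a::comm_ring_1 mpoly"
  assumes "hom_poly n w d P" "hom_poly n w d' Q"
  shows "hom_poly n w (d + d') (P * Q)"
  unfolding hom_poly_def
proof (intro allI impI)
  fix m assume "mcoeff (P * Q) m \<noteq> 0"
  then obtain u v where "m = u + v" "mcoeff P u \<noteq> 0" "mcoeff Q v \<noteq> 0"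
    by (rule mcoeff_mult_nonzeroE)
  then show "set_mset m \<subseteq> {..<n} \<and> wdeg w m = d + d'"
    using assms unfolding hom_poly_def by (metis Un_least set_mset_union wdeg_add)
qed

lemma hom_poly_one: "hom_poly n w 0 (1 :: 'a::comm_ring_1 mpoly)"
  by (auto simp: hom_poly_def lookup_one when_def)

lemma hom_poly_power:
  fixes P :: "'a::comm_ring_1 mpoly"
  assumes "hom_poly n w d P"
  shows "hom_poly n w (N * d) (P ^ N)"
  by (induction N) (auto intro: hom_poly_mult[OF assms] hom_poly_one)

lemma hom_poly_power_in_frob_ideal:
  assumes "hom_poly n w d F" "N * d > (q - 1) * (\<Sum>i<n. w i)"
  shows "F ^ N \<in> frob_ideal p q"
proof -
  have "mcoeff (F ^ N) m = 0" if "below q m" for m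
  proof (rule ccontr)
    assume nz: "mcoeff (F ^ N) m \<noteq> 0"
    then have m: "set_mset m \<subseteq> {..<n}" "wdeg w m = N * d"
      using hom_poly_power[OF assms(1), of N] unfolding hom_poly_def by blast+
    have "wdeg w m \<le> (q - 1) * (\<Sum>i<n. w i)"
      using m(1) that by (intro wdeg_le_if_counts_below) (auto simp: below_def)
    then show False using m assms(2) by simp
  qed
  then show ?thesis by (simp add: frob_ideal_def)
qed

section \<open>Partial derivatives\<close>

definition pdiff :: "nat \<Rightarrow> 'a::comm_ring_1 mpoly \<Rightarrow> 'a mpoly" where
  "pdiff i P = (\<Sum>m\<in>Poly_Mapping.keys P. mterm (m - {#i#}) (of_nat (count m i) * mcoeff P m))"

lemma mcoeff_pdiff: "mcoeff (pdiff i P) m = of_nat (Suc (count m i)) * mcoeff P (add_mset i m)"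
proof -
  have "mcoeff (mterm (k - {#i#}) (of_nat (count k i) * mcoeff P k)) m
      = (if k = add_mset i m then of_nat (Suc (count m i)) * mcoeff P (add_mset i m) else 0)" for k
  proof (cases "i \<in># k")
    case True
    then obtain l where "k = add_mset i l" by (meson multi_member_split)
    then show ?thesis by (auto simp: lookup_single when_def)
  next
    case False
    then have "k \<noteq> add_mset i m" by auto
    then show ?thesis using False by (simp add: not_in_iff)
  qed
  then have "mcoeff (pdiff i P) m = (\<Sum>k\<in>Poly_Mapping.keys P.
      if k = add_mset i m then of_nat (Suc (count m i)) * mcoeff P (add_mset i m) else 0)"
    by (simp only: pdiff_def lookup_sum)
  then show ?thesis by (auto simp: in_keys_iff)
qed

lemma pdiff_add: "pdiff i (P + Q) = pdiff i P + pdiff i Q"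
  by (rule poly_mapping_eqI) (simp add: mcoeff_pdiff lookup_add algebra_simps)

lemma pdiff_zero: "pdiff i 0 = 0"
  by (rule poly_mapping_eqI) (simp add: mcoeff_pdiff)

lemma pdiff_sum: "pdiff i (sum f A) = (\<Sum>x\<in>A. pdiff i (f x))"
  by (induction A rule: infinite_finite_induct) (auto simp: pdiff_add pdiff_zero)

lemma pdiff_mterm: "pdiff i (mterm m c) = mterm (m - {#i#}) (of_nat (count m i) * c)"
  by (cases "c = 0") (auto simp: pdiff_def)

lemma pdiff_mult_mterm:
  "pdiff i (mterm a x * mterm b y) = pdiff i (mterm a x) * mterm b y + mterm a x * pdiff i (mterm b y)"
proof (cases "i \<in># a"; cases "i \<in># b")
  assume "i \<in># a" "i \<in># b"
  then obtain a' b' where "a = add_mset i a'" "b = add_mset i b'" by (meson multi_member_split)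
  then show ?thesis by (simp add: pdiff_mterm mult_single single_add[symmetric] algebra_simps)
next
  assume "i \<in># a" "i \<notin># b"
  then obtain a' where "a = add_mset i a'" by (meson multi_member_split)
  then show ?thesis using \<open>i \<notin># b\<close> by (simp add: pdiff_mterm mult_single not_in_iff algebra_simps)
next
  assume "i \<notin># a" "i \<in># b"
  then obtain b' where "b = add_mset i b'" by (meson multi_member_split)
  then show ?thesis using \<open>i \<notin># a\<close> by (simp add: pdiff_mterm mult_single not_in_iff algebra_simps)
next
  assume "i \<notin># a" "i \<notin># b"
  then show ?thesis by (simp add: pdiff_mterm mult_single not_in_iff)
qed

lemma pdiff_mult: "pdiff i (P * Q) = pdiff i P * Q + P * pdiff i Q"
proof -
  have "pdiff i (P * mterm b y) = pdiff i P * mterm b y + P * pdiff i (mterm b y)" for b y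
  proof -
    have "pdiff i ((\<Sum>m\<in>Poly_Mapping.keys P. mterm m (mcoeff P m)) * mterm b y)
      = pdiff i (\<Sum>m\<in>Poly_Mapping.keys P. mterm m (mcoeff P m)) * mterm b y
        + (\<Sum>m\<in>Poly_Mapping.keys P. mterm m (mcoeff P m)) * pdiff i (mterm b y)"
      by (simp add: sum_distrib_right pdiff_sum pdiff_mult_mterm sum.distrib)
    then show ?thesis by (simp only: mpoly_eq_sum_terms[symmetric])
  qed
  then have "pdiff i (P * (\<Sum>m\<in>Poly_Mapping.keys Q. mterm m (mcoeff Q m)))
      = pdiff i P * (\<Sum>m\<in>Poly_Mapping.keys Q. mterm m (mcoeff Q m))
        + P * pdiff i (\<Sum>m\<in>Poly_Mapping.keys Q. mterm m (mcoeff Q m))"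
    by (simp add: sum_distrib_left pdiff_sum sum.distrib)
  then show ?thesis by (simp only: mpoly_eq_sum_terms[symmetric])
qed

lemma pdiff_power: "pdiff i (P ^ Suc N) = of_nat (Suc N) * (P ^ N * pdiff i P)"
proof (induction N)
  case (Suc N)
  have "pdiff i (P ^ Suc (Suc N)) = pdiff i P * P ^ Suc N + P * pdiff i (P ^ Suc N)"
    by (simp add: pdiff_mult)
  also have "\<dots> = of_nat (Suc (Suc N)) * (P ^ Suc N * pdiff i P)"
    unfolding Suc.IH by (simp add: algebra_simps)
  finally show ?case .
qed simp

text \<open>
  Differentiating in the direction \<open>i\<close> can leave the ideal only through \<open>x\<^sub>i\<^sup>q\<close>, whose derivative is
  divisible by \<open>q\<close> and hence by \<open>p\<close>.
\<close>

lemma pdiff_frob_ideal: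
  assumes "P \<in> frob_ideal p q" "p dvd q"
  shows "pdiff i P \<in> frob_ideal p q"
  unfolding frob_ideal_def
proof (intro CollectI allI impI)
  fix m assume m: "below q m"
  show "int p dvd mcoeff (pdiff i P) m"
  proof (cases "Suc (count m i) = q")
    case True
    then show ?thesis using assms(2) by (auto simp: mcoeff_pdiff simp flip: of_nat_Suc)
  next
    case False
    then have "Suc (count m i) < q" using m by (simp add: below_def Suc_lessI)
    then have "below q (add_mset i m)" using m by (auto simp: below_def)
    then show ?thesis using assms(1) by (auto simp: mcoeff_pdiff frob_ideal_def intro: dvd_mult)
  qed
qed

section \<open>Degree bound for colon ideals\<close>

lemma frob_ideal_cancel_const:
  assumes "prime p" "\<not> int p dvd c" "mterm {#} c * P \<in> frob_ideal p q"
  shows "P \<in> frob_ideal p q"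
  using assms prime_dvd_mult_iff[of "int p" c] by (auto simp: frob_ideal_def mcoeff_term_mult)

text \<open>
  Here \<open>g\<close> is a system of parameters of degrees \<open>\<delta>\<close>, in the sense that its ideal contains a power of each
  variable up to the unit \<open>c\<close>, and \<open>H\<close> multiplies the \<open>Q\<close>-th powers of the parameters into the Frobenius
  power. A monomial with an exponent at least \<open>K\<close> can be rewritten with one more factor \<open>g j\<close> and a monomial
  of smaller degree, without changing the total degree. Once all exponents are below \<open>K\<close>, the monomial
  contributes at most \<open>(K - 1) \<Sum>w\<close>, so the parameters carry degree above \<open>(Q - 1) \<Sum>\<delta>\<close> and one of them
  occurs at least \<open>Q\<close> times.
\<close>

lemma high_degree_mult_in_frob_ideal:
  fixes g :: "nat \<Rightarrow> int mpoly"
  assumes p: "prime p" and c: "\<not> int p dvd c" and dpos: "\<And>j. j < n \<Longrightarrow> \<delta> j > 0"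
    and rel: "\<And>i. i < n \<Longrightarrow> mterm (replicate_mset K i) c = (\<Sum>j<n. R i j * g j)"
    and R: "\<And>i j u. i < n \<Longrightarrow> j < n \<Longrightarrow> mcoeff (R i j) u \<noteq> 0 \<Longrightarrow>
              set_mset u \<subseteq> {..<n} \<and> wdeg w u + \<delta> j = K * w i"
    and H: "\<And>j. j < n \<Longrightarrow> H * g j ^ Q \<in> frob_ideal p Q'"
  shows "set_mset m \<subseteq> {..<n} \<Longrightarrow>
     (K - 1) * (\<Sum>i<n. w i) + (Q - 1) * (\<Sum>j<n. \<delta> j) < wdeg w m + (\<Sum>j<n. \<gamma> j * \<delta> j) \<Longrightarrow>
     H * mterm m 1 * (\<Prod>j<n. g j ^ \<gamma> j) \<in> frob_ideal p Q'"
proof (induction "wdeg w m" arbitrary: m \<gamma> rule: less_induct)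
  case less
  let ?G = "\<lambda>\<gamma>. \<Prod>j<n. g j ^ \<gamma> j"
  show ?case
  proof (cases "\<exists>i<n. K \<le> count m i")
    case False
    then have "wdeg w m \<le> (K - 1) * (\<Sum>i<n. w i)"
      using less.prems(1) by (intro wdeg_le_if_counts_below) (auto simp: not_le)
    then have *: "(Q - 1) * (\<Sum>j<n. \<delta> j) < (\<Sum>j<n. \<gamma> j * \<delta> j)" using less.prems(2) by linarith
    have "\<exists>j<n. Q \<le> \<gamma> j"
    proof (rule ccontr)
      assume no: "\<not> ?thesis"
      have "\<gamma> j * \<delta> j \<le> (Q - 1) * \<delta> j" if "j < n" for j
      proof -
        have "\<gamma> j \<le> Q - 1" using no that by fastforce
        then show ?thesis by (rule mult_le_mono1)
      qed
      then have "(\<Sum>j<n. \<gamma> j * \<delta> j) \<le> (Q - 1) * (\<Sum>j<n. \<delta> j)"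
        unfolding sum_distrib_left by (intro sum_mono) simp
      then show False using * by simp
    qed
    then obtain j where j: "j < n" "Q \<le> \<gamma> j" by blast
    have "?G \<gamma> = g j ^ \<gamma> j * (\<Prod>j\<in>{..<n} - {j}. g j ^ \<gamma> j)"
      using j by (intro prod.remove) auto
    moreover have "g j ^ \<gamma> j = g j ^ Q * g j ^ (\<gamma> j - Q)" using j by (simp flip: power_add)
    ultimately have "H * mterm m 1 * ?G \<gamma>
        = (H * g j ^ Q) * (mterm m 1 * g j ^ (\<gamma> j - Q) * (\<Prod>j\<in>{..<n} - {j}. g j ^ \<gamma> j))"
      by (simp add: ac_simps)
    then show ?thesis using frob_ideal_mult[OF H[OF j(1)]] by simp
  next
    case True
    then obtain i where i: "i < n" "K \<le> count m i" by blast
    then have "replicate_mset K i \<subseteq># m" by (simp add: count_le_replicate_mset_subset_eq)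
    then obtain m' where m: "m = replicate_mset K i + m'" by (metis subset_mset.add_diff_inverse)
    have step: "H * mterm m' 1 * mterm u r * (g j * ?G \<gamma>) \<in> frob_ideal p Q'"
      if j: "j < n" and u: "set_mset u \<subseteq> {..<n}" "wdeg w u + \<delta> j = K * w i" for j u r
    proof -
      let ?\<gamma> = "\<gamma>(j := Suc (\<gamma> j))"
      have G: "?G ?\<gamma> = g j * ?G \<gamma>"
      proof -
        have "?G ?\<gamma> = g j ^ Suc (\<gamma> j) * (\<Prod>k\<in>{..<n} - {j}. g k ^ ?\<gamma> k)"
          using j by (subst prod.remove[of _ j]) auto
        also have "(\<Prod>k\<in>{..<n} - {j}. g k ^ ?\<gamma> k) = (\<Prod>k\<in>{..<n} - {j}. g k ^ \<gamma> k)"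
          by (intro prod.cong) auto
        also have "g j ^ Suc (\<gamma> j) * \<dots> = g j * ?G \<gamma>"
          using j by (subst (2) prod.remove[of _ j]) (auto simp: mult.assoc)
        finally show ?thesis .
      qed
      have S: "(\<Sum>k<n. ?\<gamma> k * \<delta> k) = \<delta> j + (\<Sum>k<n. \<gamma> k * \<delta> k)"
      proof -
        have "(\<Sum>k<n. ?\<gamma> k * \<delta> k) = (\<Sum>k<n. \<gamma> k * \<delta> k + (if k = j then \<delta> j else 0))"
          by (intro sum.cong) auto
        then show ?thesis using j by (simp add: sum.distrib)
      qed
      have deg: "wdeg w (m' + u) + \<delta> j = wdeg w m" using u by (simp add: m)
      have "H * mterm (m' + u) 1 * ?G ?\<gamma> \<in> frob_ideal p Q'"
      proof (rule less.hyps)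
        show "wdeg w (m' + u) < wdeg w m" using deg dpos[OF j] by linarith
        show "set_mset (m' + u) \<subseteq> {..<n}" using less.prems(1) u(1) by (auto simp: m)
        show "(K - 1) * (\<Sum>i<n. w i) + (Q - 1) * (\<Sum>j<n. \<delta> j) < wdeg w (m' + u) + (\<Sum>k<n. ?\<gamma> k * \<delta> k)"
          unfolding S using less.prems(2) deg by linarith
      qed
      then have "mterm {#} r * (H * mterm (m' + u) 1 * ?G ?\<gamma>) \<in> frob_ideal p Q'"
        by (rule frob_ideal_mult')
      moreover have "mterm m' 1 * mterm u r = mterm {#} r * mterm (m' + u) 1"
        by (simp add: mult_single)
      then have "H * mterm m' 1 * mterm u r * (g j * ?G \<gamma>) = mterm {#} r * (H * mterm (m' + u) 1 * ?G ?\<gamma>)"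
        unfolding G by (metis (no_types, lifting) mult.assoc mult.commute)
      ultimately show ?thesis by simp
    qed
    have "H * mterm m' 1 * R i j * (g j * ?G \<gamma>) \<in> frob_ideal p Q'" if j: "j < n" for j
    proof -
      have "H * mterm m' 1 * (\<Sum>u\<in>Poly_Mapping.keys (R i j). mterm u (mcoeff (R i j) u)) * (g j * ?G \<gamma>) \<in> frob_ideal p Q'"
        unfolding sum_distrib_left sum_distrib_right
        using R[OF i(1) j] by (intro frob_ideal_sum step[OF j]) (auto simp: in_keys_iff)
      then show ?thesis by (simp only: mpoly_eq_sum_terms[symmetric])
    qed
    then have "(\<Sum>j<n. H * mterm m' 1 * R i j * (g j * ?G \<gamma>)) \<in> frob_ideal p Q'"
      by (intro frob_ideal_sum) auto
    also have "(\<Sum>j<n. H * mterm m' 1 * R i j * (g j * ?G \<gamma>)) = H * mterm m' 1 * ?G \<gamma> * (\<Sum>j<n. R i j * g j)"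
      unfolding sum_distrib_left by (intro sum.cong refl) (simp add: ac_simps)
    also have "\<dots> = H * mterm m' 1 * ?G \<gamma> * mterm (replicate_mset K i) c" using rel[OF i(1)] by simp
    also have "\<dots> = mterm {#} c * (H * mterm m 1 * ?G \<gamma>)"
    proof -
      have "mterm m' 1 * mterm (replicate_mset K i) c = mterm {#} c * mterm m 1"
        by (simp add: m mult_single add.commute)
      then show ?thesis by (metis (no_types, lifting) mult.assoc mult.commute)
    qed
    finally show ?thesis by (rule frob_ideal_cancel_const[OF p c])
  qed
qed

lemma mcoeff_power_frobenius:
  assumes "prime p"
  shows "int p dvd mcoeff (P ^ (p ^ e)) (repeat_mset (p ^ e) m) - mcoeff P m"
proof -
  have q: "p ^ e > 0" using assms prime_gt_0_nat by simp
  have "mcoeff (subst_power (p ^ e) P) (repeat_mset (p ^ e) m)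
      = (\<Sum>k\<in>Poly_Mapping.keys P. if k = m then mcoeff P m else 0)"
    unfolding subst_power_def lookup_sum using q
    by (intro sum.cong) (auto simp: lookup_single when_def repeat_mset_cancel1)
  then have "mcoeff (subst_power (p ^ e) P) (repeat_mset (p ^ e) m) = mcoeff P m"
    by (auto simp: in_keys_iff)
  then show ?thesis
    using of_nat_dvd_mcoeff[OF power_dvd_subst_power[OF assms, of P e], of "repeat_mset (p ^ e) m"]
    by (simp add: lookup_minus)
qed

text \<open>
  If \<open>G\<close> multiplies the parameters into \<open>\<mm>\<^bsup>[q]\<^esup>\<close>, then \<open>G\<^sup>Q\<close> multiplies their \<open>Q\<close>-th powers into \<open>\<mm>\<^bsup>[Qq]\<^esup>\<close>. Let \<open>m0\<close> be
  a monomial of \<open>G\<close> outside \<open>\<mm>\<^bsup>[q]\<^esup>\<close> whose coefficient is a unit modulo \<open>p\<close>. The complement \<open>\<alpha>\<close> of \<open>Q m0\<close> in the socle monomial of \<open>\<mm>\<^bsup>[Qq]\<^esup>\<close> satisfies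
  \<open>G\<^sup>Q x\<^sup>\<alpha> \<notin> \<mm>\<^bsup>[Qq]\<^esup>\<close>, so its degree \<open>(Qq - 1) \<Sum>w - Q D\<close> cannot exceed \<open>(K - 1) \<Sum>w + (Q - 1) \<Sum>\<delta>\<close>. Dividing by \<open>Q\<close> and
  letting \<open>Q\<close> grow gives the claim; a single \<open>Q > K \<Sum>w + \<Sum>w\<close> is large enough because all degrees are integers.
\<close>

lemma degree_of_colon_element:
  fixes g :: "nat \<Rightarrow> int mpoly"
  assumes p: "prime p" and c: "\<not> int p dvd c" and dpos: "\<And>j. j < n \<Longrightarrow> \<delta> j > 0"
    and rel: "\<And>i. i < n \<Longrightarrow> mterm (replicate_mset K i) c = (\<Sum>j<n. R i j * g j)"
    and R: "\<And>i j u. i < n \<Longrightarrow> j < n \<Longrightarrow> mcoeff (R i j) u \<noteq> 0 \<Longrightarrow>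
              set_mset u \<subseteq> {..<n} \<and> wdeg w u + \<delta> j = K * w i"
    and G: "hom_poly n w D G" "G \<notin> frob_ideal p q" and q: "q > 0"
    and Gg: "\<And>j. j < n \<Longrightarrow> G * g j \<in> frob_ideal p q"
  shows "q * (\<Sum>i<n. w i) \<le> D + (\<Sum>j<n. \<delta> j)"
proof (rule ccontr)
  let ?s = "\<Sum>i<n. w i" and ?S = "\<Sum>j<n. \<delta> j"
  assume "\<not> ?thesis"
  then have gt: "q * ?s \<ge> D + ?S + 1" by simp
  obtain m0 where m0: "below q m0" "\<not> int p dvd mcoeff G m0" using G(2) by (auto simp: frob_ideal_def)
  then have m0': "set_mset m0 \<subseteq> {..<n}" "wdeg w m0 = D"
    using G(1) unfolding hom_poly_def by (metis dvd_0_right)+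
  define e where "e = K * ?s + ?s"
  define Q where "Q = p ^ e"
  have Q: "Q > e" unfolding Q_def using power_gt_expt[of p e] prime_gt_1_nat[OF p] by simp
  then have Qq: "Q * q > 0" using q by simp
  have sub: "repeat_mset Q m0 \<subseteq># top_monom n (Q * q)"
    unfolding subseteq_mset_def
  proof
    fix i
    show "count (repeat_mset Q m0) i \<le> count (top_monom n (Q * q)) i"
    proof (cases "i < n")
      case True
      have "count m0 i < q" using m0(1) by (simp add: below_def)
      then have "Q * count m0 i < Q * q" using Q by (intro mult_strict_left_mono) auto
      then have "Q * count m0 i \<le> Q * q - 1" by linarith
      then show ?thesis using True by (simp add: count_top_monom)
    next
      case False
      then have "count m0 i = 0" using m0' by (metis lessThan_iff not_in_iff subsetD)
      then show ?thesis by simp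
    qed
  qed
  define \<alpha> where "\<alpha> = top_monom n (Q * q) - repeat_mset Q m0"
  have top: "top_monom n (Q * q) = repeat_mset Q m0 + \<alpha>" using sub by (simp add: \<alpha>_def)
  have set\<alpha>: "set_mset \<alpha> \<subseteq> {..<n}" using set_top_monom[of n "Q * q"] top by simp
  have deg\<alpha>: "wdeg w \<alpha> + Q * D = (Q * q - 1) * ?s"
    using wdeg_top_monom[of w n "Q * q"] m0' by (simp add: top)
  have "G ^ Q * mterm \<alpha> 1 \<notin> frob_ideal p (Q * q)"
  proof
    assume "G ^ Q * mterm \<alpha> 1 \<in> frob_ideal p (Q * q)"
    moreover have "below (Q * q) (top_monom n (Q * q))" using Qq by (auto simp: below_def count_top_monom)
    ultimately have "int p dvd mcoeff (mterm \<alpha> 1 * G ^ Q) (top_monom n (Q * q))"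
      by (simp add: frob_ideal_def mult.commute)
    then have "int p dvd mcoeff (G ^ Q) (repeat_mset Q m0)" by (simp add: mcoeff_term_mult top)
    then show False using mcoeff_power_frobenius[OF p, of G e m0] m0(2) unfolding Q_def
      by (metis diff_add_cancel dvd_diff_commute dvd_add_right_iff)
  qed
  moreover have "G ^ Q * g j ^ Q \<in> frob_ideal p (Q * q)" if "j < n" for j
    using Gg[OF that] frob_ideal_power_iff[OF p Q_def] by (simp flip: power_mult_distrib)
  ultimately have "\<not> (K - 1) * ?s + (Q - 1) * ?S < wdeg w \<alpha> + (\<Sum>j<n. 0 * \<delta> j)"
    using high_degree_mult_in_frob_ideal[OF p c dpos rel R, where H="G ^ Q" and Q=Q and Q'="Q * q"
       and m=\<alpha> and \<gamma>="\<lambda>_. 0"] set\<alpha> by auto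
  then have "wdeg w \<alpha> \<le> (K - 1) * ?s + (Q - 1) * ?S" by simp
  then have "(Q * q - 1) * ?s \<le> (K - 1) * ?s + (Q - 1) * ?S + Q * D" using deg\<alpha> by linarith
  moreover have "(K - 1) * ?s \<le> K * ?s" "(Q - 1) * ?S \<le> Q * ?S" by (simp_all add: mult_le_mono1)
  moreover have "(Q * q - 1) * ?s + ?s = Q * (q * ?s)"
    using Qq by (metis Suc_pred' mult.assoc mult_Suc add.commute)
  moreover have "Q * (D + ?S + 1) \<le> Q * (q * ?s)" using gt by (rule mult_le_mono2)
  moreover have "Q * (D + ?S + 1) = Q * D + Q * ?S + Q" by (simp add: distrib_left)
  ultimately have "Q * D + Q * ?S + Q \<le> e + Q * ?S + Q * D"
    unfolding e_def by linarith
  then show False using Q by simp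
qed

section \<open>Thresholds of sequences of Frobenius exponents\<close>

text \<open>
  The properties of \<open>\<nu>\<close> that determine how the threshold sits below \<open>min \<mu> 1\<close>. The assumption \<open>V_drop\<close>
  is the degree bound coming from the isolated singularity, and \<open>V_keep\<close> together with \<open>V_Suc_le\<close> says
  that \<open>(V e + 1) / p\<^sup>e\<close> is unchanged from \<open>e\<close> to \<open>e + 1\<close> when \<open>p\<close> divides \<open>V (e + 1) + 1\<close>.
\<close>

locale nu_sequence =
  fixes p n :: nat and \<mu> :: real and V :: "nat \<Rightarrow> nat"
  assumes prime: "prime p"
    and V0: "V 0 = 0"
    and V_le: "real (V e) \<le> (real (p ^ e) - 1) * \<mu>"
    and V_less: "V e < p ^ e"
    and V_super: "p ^ e * V e' + V e \<le> V (e + e')"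
    and V_Suc_le: "V (Suc e) + 1 \<le> p * (V e + 1)"
    and V_keep: "p dvd V (Suc e) + 1 \<Longrightarrow> p * (V e + 1) \<le> V (Suc e) + 1"
    and V_drop: "e > 0 \<Longrightarrow> \<not> p dvd V e + 1 \<Longrightarrow> (real (p ^ e) + 1) * \<mu> \<le> real (V e) + real n"
begin

definition threshold :: real where
  "threshold = lim (\<lambda>e. real (V e) / real (p ^ e))"

lemma p_gt_1: "p > 1"
  using prime prime_gt_1_nat by blast

lemma pe_pos: "real (p ^ e) > 0"
  using p_gt_1 by simp

lemma tendsto_threshold: "(\<lambda>e. real (V e) / real (p ^ e)) \<longlonglongrightarrow> threshold"
  and quotient_le_threshold: "real (V e) / real (p ^ e) \<le> threshold"
proof -
  let ?v = "\<lambda>e. real (V e) / real (p ^ e)"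
  have "incseq ?v"
  proof (rule incseq_SucI)
    fix e
    have "p * V e \<le> V (Suc e)" using V_super[of 1 e] by simp
    then have "real p * real (V e) \<le> real (V (Suc e))" by (metis of_nat_le_iff of_nat_mult)
    then show "?v e \<le> ?v (Suc e)" using p_gt_1 by (simp add: field_simps)
  qed
  moreover have bound: "?v e \<le> 1" for e
    using V_less[of e] pe_pos[of e] by (simp only: divide_le_eq) simp
  have "Bseq ?v" by (rule BseqI'[of _ 1]) (use bound in auto)
  ultimately have conv: "convergent ?v"
    by (intro Bseq_monoseq_convergent) (auto simp: monoseq_iff)
  then show lim: "?v \<longlonglongrightarrow> threshold" unfolding threshold_def by (simp add: convergent_LIMSEQ_iff)
  show "?v e \<le> threshold" by (rule incseq_le[OF \<open>incseq ?v\<close> lim])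
qed

lemma tendsto_upper: "(\<lambda>e. (real (V e) + 1) / real (p ^ e)) \<longlonglongrightarrow> threshold"
proof -
  have "(\<lambda>e. (1 / real p) ^ e) \<longlonglongrightarrow> 0" using p_gt_1 by (intro LIMSEQ_power_zero) auto
  then have "(\<lambda>e. real (V e) / real (p ^ e) + (1 / real p) ^ e) \<longlonglongrightarrow> threshold + 0"
    by (intro tendsto_add tendsto_threshold)
  then show ?thesis by (simp add: add_divide_distrib power_divide)
qed

lemma threshold_le_upper: "threshold \<le> (real (V e) + 1) / real (p ^ e)"
proof -
  have "decseq (\<lambda>e. (real (V e) + 1) / real (p ^ e))"
  proof (rule decseq_SucI)
    fix e
    have "real (V (Suc e) + 1) \<le> real (p * (V e + 1))" using V_Suc_le of_nat_le_iff by blast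
    show "(real (V (Suc e)) + 1) / real (p ^ Suc e) \<le> (real (V e) + 1) / real (p ^ e)"
    proof -
      have "(real (V (Suc e)) + 1) / real p \<le> real (V e) + 1"
        using \<open>real (V (Suc e) + 1) \<le> real (p * (V e + 1))\<close> p_gt_1 by (simp add: divide_le_eq algebra_simps)
      then have "(real (V (Suc e)) + 1) / real p / real (p ^ e) \<le> (real (V e) + 1) / real (p ^ e)"
        by (rule divide_right_mono) simp
      then show ?thesis by simp
    qed
  qed
  then show ?thesis by (rule decseq_ge[OF _ tendsto_upper])
qed

definition lam :: real where "lam = min \<mu> 1"

lemma mu_nonneg: "\<mu> \<ge> 0"
proof -
  have "0 \<le> (real p - 1) * \<mu>" using order_trans[OF _ V_le[of 1]] by simp
  then show ?thesis using p_gt_1 by (simp add: zero_le_mult_iff)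
qed

lemma threshold_le_lam: "threshold \<le> lam"
proof -
  note \<mu> = mu_nonneg
  have "real (V e) / real (p ^ e) \<le> lam" for e
  proof -
    have "real (V e) \<le> real (p ^ e) * \<mu>" using V_le[of e] \<mu> by (simp add: algebra_simps)
    moreover have "real (V e) \<le> real (p ^ e)" using V_less[of e] by linarith
    ultimately show ?thesis using pe_pos[of e] by (simp add: lam_def divide_le_eq mult.commute)
  qed
  then show ?thesis by (intro LIMSEQ_le_const2[OF tendsto_threshold]) auto
qed

text \<open>
  At a drop \<open>e\<close> one has \<open>(V e + 1) / p\<^sup>e \<ge> \<mu> - n / p\<^sup>e\<close>. Drops at arbitrarily large \<open>e\<close> would therefore push the limit
  up to \<open>\<mu>\<close>. After the last drop the sequence \<open>(V e + 1) / p\<^sup>e\<close> is constant, and a sequence without any drop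
  would keep its initial value \<open>1\<close>.
\<close>

lemma threshold_eq_last_drop:
  assumes "threshold \<noteq> lam"
  obtains L where "L > 0" "threshold = (real (V L) + 1) / real (p ^ L)"
    "(real (p ^ L) + 1) * \<mu> \<le> real (V L) + real n"
proof -
  have less: "threshold < lam" using assms threshold_le_lam by simp
  have \<mu>: "threshold < \<mu>" using less by (simp add: lam_def)
  have "(\<lambda>e. real n * (1 / real p) ^ e) \<longlonglongrightarrow> real n * 0"
    using p_gt_1 by (intro tendsto_mult tendsto_const LIMSEQ_power_zero) auto
  then have "(\<lambda>e. (real (V e) + 1) / real (p ^ e) + real n * (1 / real p) ^ e) \<longlonglongrightarrow> threshold + 0"
    by (intro tendsto_add tendsto_upper) simp
  then have "\<forall>\<^sub>F e in sequentially. (real (V e) + 1) / real (p ^ e) + real n * (1 / real p) ^ e < \<mu>"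
    using \<mu> by (intro order_tendstoD) auto
  then have "\<forall>\<^sub>F e in sequentially. p dvd V e + 1"
    using eventually_gt_at_top[of 0]
  proof eventually_elim
    case (elim e)
    then have "real (V e) + 1 + real n < \<mu> * real (p ^ e)"
      using pe_pos[of e] by (simp add: field_simps power_divide)
    then have "\<not> (real (p ^ e) + 1) * \<mu> \<le> real (V e) + real n" using mu_nonneg by (simp add: algebra_simps)
    then show ?case using V_drop[OF elim(2)] by blast
  qed
  then have ex: "\<exists>N. \<forall>e>N. p dvd V e + 1" unfolding eventually_sequentially by (meson less_imp_le)
  define L where "L = (LEAST N. \<forall>e>N. p dvd V e + 1)"
  have L: "\<forall>e>L. p dvd V e + 1" unfolding L_def using ex by (rule LeastI_ex)
  have const: "(real (V (L + k)) + 1) / real (p ^ (L + k)) = (real (V L) + 1) / real (p ^ L)" for k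
  proof (induction k)
    case (Suc k)
    have "p dvd V (Suc (L + k)) + 1" using L by simp
    then have "V (Suc (L + k)) + 1 = p * (V (L + k) + 1)" using V_keep V_Suc_le by (meson le_antisym)
    then have "real (V (Suc (L + k))) + 1 = real p * (real (V (L + k)) + 1)"
      by (metis of_nat_1 of_nat_add of_nat_mult)
    then show ?case using Suc p_gt_1 by simp
  qed simp
  have "(\<lambda>k. (real (V (k + L)) + 1) / real (p ^ (k + L))) \<longlonglongrightarrow> threshold"
    by (rule LIMSEQ_ignore_initial_segment[OF tendsto_upper])
  then have "(\<lambda>k::nat. (real (V L) + 1) / real (p ^ L)) \<longlonglongrightarrow> threshold" by (simp only: const add.commute[of _ L])
  then have thr: "threshold = (real (V L) + 1) / real (p ^ L)" by (simp add: LIMSEQ_const_iff)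
  have L0: "L > 0"
  proof (rule ccontr)
    assume "\<not> L > 0"
    then have "threshold = 1" using thr V0 by simp
    then show False using less by (simp add: lam_def)
  qed
  have "\<not> p dvd V L + 1"
  proof
    assume d: "p dvd V L + 1"
    have "\<forall>e>L - 1. p dvd V e + 1"
    proof (intro allI impI)
      fix e assume "e > L - 1"
      then have "e = L \<or> e > L" by linarith
      then show "p dvd V e + 1" using d L by blast
    qed
    then have "L \<le> L - 1" unfolding L_def by (rule Least_le)
    then show False using L0 by simp
  qed
  then show ?thesis using that[OF L0 thr] V_drop[OF L0] by blast
qed

text \<open>
  Superadditivity carries the inequality from \<open>k\<close> to all multiples \<open>j k\<close>, and there it says
  \<open>V (j k) / p\<^bsup>jk\<^esup> \<ge> lam - lam / p\<^bsup>jk\<^esup>\<close>.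
\<close>

lemma threshold_ge_lam_if_integral:
  assumes o: "k > 0" and Vk: "lam * (real (p ^ k) - 1) \<le> real (V k)"
  shows "lam \<le> threshold"
proof (rule ccontr)
  assume "\<not> ?thesis"
  then have eps: "lam - threshold > 0" by simp
  have V: "lam * (real (p ^ (j * k)) - 1) \<le> real (V (j * k))" for j
  proof (induction j)
    case (Suc j)
    have "real (p ^ k) * (lam * (real (p ^ (j * k)) - 1)) + lam * (real (p ^ k) - 1)
        \<le> real (p ^ k) * real (V (j * k)) + real (V k)"
      using Suc Vk by (intro add_mono mult_left_mono) auto
    also have "\<dots> = real (p ^ k * V (j * k) + V k)" by simp
    also have "\<dots> \<le> real (V (k + j * k))" using V_super of_nat_le_iff by blast
    finally show ?case by (simp add: algebra_simps power_add)
  qed simp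
  obtain j :: nat where j: "real j > lam / (lam - threshold)" using reals_Archimedean2 by blast
  have "j * k < p ^ (j * k)" using power_gt_expt p_gt_1 by simp
  moreover have "j \<le> j * k" using o by simp
  ultimately have "real j < real (p ^ (j * k))" by linarith
  then have "lam < (lam - threshold) * real (p ^ (j * k))" 
  proof -
    have "lam < (lam - threshold) * real j" using j eps by (simp add: divide_less_eq mult.commute)
    also have "\<dots> < (lam - threshold) * real (p ^ (j * k))"
      using eps \<open>real j < real (p ^ (j * k))\<close> by (rule mult_strict_left_mono[rotated])
    finally show ?thesis .
  qed
  moreover have "real (V (j * k)) \<le> threshold * real (p ^ (j * k))"
    using quotient_le_threshold[of "j * k"] pe_pos[of "j * k"] by (simp add: divide_le_eq)
  ultimately show False using V[of j] by (simp add: algebra_simps)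
qed

text \<open>
  The gap is governed by the last drop \<open>L\<close>. Its size is at most \<open>(n - 1 - lam) / p\<^sup>L\<close> by the degree bound at \<open>L\<close>,
  and at least \<open>1 / (b p\<^sup>L)\<close> because \<open>b p\<^sup>L (lam - threshold)\<close> is a positive integer. It remains to see
  that \<open>L\<close> does not exceed the order of \<open>p\<close> modulo \<open>b\<close>.
\<close>

theorem threshold_gap:
  assumes ab: "0 < a" "0 < b" "lam = real a / real b" and cop: "coprime b p"
    and big: "n * b \<le> p" and neq: "threshold \<noteq> lam"
  shows "(1 / real b) / real p ^ ord b p \<le> lam - threshold"
    and "lam - threshold \<le> (real n - 1 - 1 / real b) / real p"
proof -
  obtain L where L: "L > 0" "threshold = (real (V L) + 1) / real (p ^ L)"
    "(real (p ^ L) + 1) * \<mu> \<le> real (V L) + real n"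
    using threshold_eq_last_drop[OF neq] by blast
  have pos: "lam - threshold > 0" using neq threshold_le_lam by simp
  let ?q = "real (p ^ L)"
  have thr: "threshold * ?q = real (V L) + 1" using L(2) pe_pos[of L] by simp
  have lam_ge: "lam \<ge> 1 / real b" using ab by (simp add: divide_right_mono)
  have "(lam - threshold) * ?q \<le> real n - 1 - lam"
  proof -
    have "(?q + 1) * lam \<le> (?q + 1) * \<mu>" by (intro mult_left_mono) (auto simp: lam_def)
    then have "(?q + 1) * lam \<le> threshold * ?q - 1 + real n" using L(3) thr by linarith
    then show ?thesis by (simp add: algebra_simps)
  qed
  then have up: "(lam - threshold) * ?q \<le> real n - 1 - 1 / real b" using lam_ge by linarith
  have "real p \<le> ?q" using L(1) p_gt_1 by (cases L) auto
  then have "(lam - threshold) * real p \<le> (lam - threshold) * ?q" using pos by simp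
  then show upper: "lam - threshold \<le> (real n - 1 - 1 / real b) / real p"
    using up p_gt_1 by (simp add: le_divide_eq)
  define k where "k = ord b p"
  have k: "k > 0" "[p ^ k = 1] (mod b)"
    unfolding k_def using cop ord_works[of p b] by auto
  (* Otherwise the gap is smaller than lam / p^k, so that V k reaches the integer lam (p^k - 1). *)
  have "L \<le> k"
  proof (rule ccontr)
    assume "\<not> L \<le> k"
    then have kL: "k < L" by simp
    have "(real n - 1 - 1 / real b) * real b < real p"
    proof -
      have "real (n * b) \<le> real p" using big of_nat_le_iff by blast
      then show ?thesis using ab by (simp add: algebra_simps)
    qed
    then have small: "(real n - 1 - 1 / real b) / real p < 1 / real b"
      using ab p_gt_1 by (simp add: divide_less_eq less_divide_eq mult.commute)
    have "(lam - threshold) * (real (p ^ k) * real p) \<le> (lam - threshold) * ?q"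
    proof -
      have "p ^ Suc k \<le> p ^ L" using kL p_gt_1 by (intro power_increasing) auto
      then have "real (p ^ k) * real p \<le> ?q" by (metis of_nat_le_iff of_nat_mult power_Suc2)
      then show ?thesis using pos by simp
    qed
    then have "(lam - threshold) * real (p ^ k) * real p \<le> real n - 1 - 1 / real b" using up by (simp add: mult.assoc)
    then have "(lam - threshold) * real (p ^ k) \<le> (real n - 1 - 1 / real b) / real p"
      using p_gt_1 by (simp add: le_divide_eq)
    then have gap: "(lam - threshold) * real (p ^ k) < lam" using small lam_ge by linarith
    have "threshold * real (p ^ k) \<le> real (V k) + 1"
      using threshold_le_upper[of k] pe_pos[of k] by (simp add: le_divide_eq)
    then have *: "lam * (real (p ^ k) - 1) < real (V k) + 1"
      using gap by (simp add: algebra_simps)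
    (* Both sides of the strict inequality are integers, as b divides p^k - 1. *)
    have "b dvd p ^ k - 1" using k(2) p_gt_1 cong_altdef_nat[of 1 "p ^ k" b] by simp
    then obtain t where t: "p ^ k - 1 = b * t" by (auto simp: dvd_def)
    then have "real (p ^ k) - 1 = real b * real t" using p_gt_1
      by (metis of_nat_1 of_nat_diff of_nat_mult one_le_power less_imp_le)
    then have z: "lam * (real (p ^ k) - 1) = real (a * t)" using ab by simp
    then have "a * t < V k + 1" using * by linarith
    then have "real (a * t) \<le> real (V k)" by (simp only: of_nat_le_iff)
    then have "lam * (real (p ^ k) - 1) \<le> real (V k)" using z by simp
    then show False using threshold_ge_lam_if_integral[OF k(1)] pos by simp
  qed
  have "(lam - threshold) * ?q * real b = real (a * p ^ L) - real (b * (V L + 1))"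
  proof -
    have "(lam - threshold) * ?q * real b = lam * real b * ?q - threshold * ?q * real b" by (simp add: algebra_simps)
    then show ?thesis unfolding thr using ab by (simp add: algebra_simps)
  qed
  moreover have "0 < (lam - threshold) * ?q * real b" using pos pe_pos ab by (intro mult_pos_pos) auto
  ultimately have eq: "(lam - threshold) * ?q * real b = real (a * p ^ L) - real (b * (V L + 1))"
    and less: "real (b * (V L + 1)) < real (a * p ^ L)" by simp_all
  from less have "b * (V L + 1) + 1 \<le> a * p ^ L" unfolding of_nat_less_iff by simp
  then have "real (b * (V L + 1) + 1) \<le> real (a * p ^ L)" unfolding of_nat_le_iff .
  then have "1 \<le> (lam - threshold) * ?q * real b" unfolding eq by simp
  then have "1 / (real b * ?q) \<le> lam - threshold" using ab pe_pos[of L] by (simp add: divide_le_eq mult_ac)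
  moreover have "1 / (real b * real (p ^ k)) \<le> 1 / (real b * ?q)"
  proof -
    have "p ^ L \<le> p ^ k" using \<open>L \<le> k\<close> p_gt_1 by (intro power_increasing) auto
    then have "?q \<le> real (p ^ k)" using of_nat_le_iff by blast
    then show ?thesis using ab pe_pos by (intro divide_left_mono mult_left_mono mult_pos_pos) auto
  qed
  ultimately show "(1 / real b) / real p ^ ord b p \<le> lam - threshold" by (simp add: k_def)
qed

end

section \<open>Quasi-homogeneous polynomials with an isolated singularity modulo p\<close>

text \<open>
  Data over the integers from which the behaviour at all but finitely many primes can be read off: \<open>F\<close> is
  homogeneous and its Jacobian ideal contains \<open>c\<close> times a power of each variable, so the singularity
  remains isolated modulo every prime not dividing \<open>c\<close>. The cofactors \<open>R\<close> are homogeneous too.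
\<close>

locale quasi_homogeneous =
  fixes n :: nat and w :: "nat \<Rightarrow> nat" and d :: nat and F :: "int mpoly"
    and K :: nat and c :: int and R :: "nat \<Rightarrow> nat \<Rightarrow> int mpoly"
  assumes n_pos: "n > 0"
    and w_less: "i < n \<Longrightarrow> w i < d"
    and F_hom: "hom_poly n w d F"
    and var_power: "i < n \<Longrightarrow> mterm (replicate_mset K i) c = (\<Sum>j<n. R i j * pdiff j F)"
    and R_hom: "i < n \<Longrightarrow> j < n \<Longrightarrow> mcoeff (R i j) u \<noteq> 0 \<Longrightarrow>
              set_mset u \<subseteq> {..<n} \<and> wdeg w u + (d - w j) = K * w i"
begin

lemma F_in_frob_ideal_1: "F \<in> frob_ideal p 1"
proof -
  have "mcoeff F {#} = 0"
    using F_hom n_pos w_less[of 0] unfolding hom_poly_def by (metis bot_nat_0.extremum_strict wdeg_empty)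
  moreover have "m = {#}" if "below 1 m" for m using that by (simp add: below_def multiset_eq_iff)
  ultimately have "int p dvd mcoeff F m" if "below 1 m" for m using that by fastforce
  then show ?thesis by (simp add: frob_ideal_def)
qed

definition nu :: "nat \<Rightarrow> nat \<Rightarrow> nat" where
  "nu p e = Max {N. F ^ N \<notin> frob_ideal p (p ^ e)}"

context
  fixes p assumes p: "prime p" "\<not> int p dvd c"
begin

lemma F_power_in: "F ^ (p ^ e) \<in> frob_ideal p (p ^ e)"
  using frob_ideal_power_iff[OF p(1) refl, of F e 1] F_in_frob_ideal_1 by simp

lemma power_in_mono: "F ^ N \<in> frob_ideal p q \<Longrightarrow> N \<le> M \<Longrightarrow> F ^ M \<in> frob_ideal p q"
  using frob_ideal_mult[of "F ^ N" p q "F ^ (M - N)"] by (simp flip: power_add)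

lemma notin_iff_le_nu: "F ^ N \<notin> frob_ideal p (p ^ e) \<longleftrightarrow> N \<le> nu p e"
proof -
  let ?A = "{N. F ^ N \<notin> frob_ideal p (p ^ e)}"
  have "?A \<subseteq> {..<p ^ e}" using power_in_mono[OF F_power_in] by (auto simp: not_le[symmetric])
  then have fin: "finite ?A" by (rule finite_subset) simp
  have "0 \<in> ?A" using one_notin_frob_ideal[OF p(1)] prime_gt_0_nat[OF p(1)] by simp
  then have "nu p e \<in> ?A" unfolding nu_def using fin by (intro Max_in) blast+
  then have "F ^ nu p e \<notin> frob_ideal p (p ^ e)" by simp
  moreover have "N \<le> nu p e" if "F ^ N \<notin> frob_ideal p (p ^ e)"
    unfolding nu_def using fin that by (intro Max_ge) auto
  ultimately show ?thesis using power_in_mono by blast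
qed

lemma in_iff_gt_nu: "F ^ N \<in> frob_ideal p (p ^ e) \<longleftrightarrow> nu p e < N"
  using notin_iff_le_nu[of N e] by auto

text \<open>
  Writing \<open>N\<close> for \<open>nu p e\<close>, the derivative of \<open>F\<^bsup>N+1\<^esup>\<close> is \<open>(N + 1) F\<^sup>N\<close> times that of \<open>F\<close>, and \<open>N + 1\<close> is a unit.
  Thus \<open>F\<^sup>N\<close> lies in the colon ideal to which the degree bound applies, with \<open>\<Sum>(d - w j) = n d - \<Sum>w\<close>.
\<close>

lemma drop_bound:
  assumes "e > 0" "\<not> p dvd nu p e + 1"
  shows "(p ^ e + 1) * (\<Sum>i<n. w i) \<le> (nu p e + n) * d"
proof -
  let ?N = "nu p e" and ?q = "p ^ e" and ?s = "\<Sum>i<n. w i"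
  have q: "?q > 0" using p prime_gt_0_nat by simp
  have "F ^ ?N * pdiff j F \<in> frob_ideal p ?q" for j
  proof -
    have "F ^ Suc ?N \<in> frob_ideal p ?q" by (simp only: in_iff_gt_nu)
    then have "pdiff j (F ^ Suc ?N) \<in> frob_ideal p ?q" using assms(1) by (intro pdiff_frob_ideal) auto
    then have "mterm {#} (int (Suc ?N)) * (F ^ ?N * pdiff j F) \<in> frob_ideal p ?q"
      unfolding pdiff_power by (simp add: single_of_nat[symmetric])
    moreover have "\<not> int p dvd int (Suc ?N)" using assms(2) by (simp only: int_dvd_int_iff) simp
    ultimately show ?thesis using frob_ideal_cancel_const[OF p(1)] by blast
  qed
  moreover have "F ^ ?N \<notin> frob_ideal p ?q" by (simp only: notin_iff_le_nu)
  ultimately have "?q * ?s \<le> ?N * d + (\<Sum>j<n. d - w j)"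
    using degree_of_colon_element[OF p, of n "\<lambda>j. d - w j" K R "\<lambda>j. pdiff j F" w "?N * d" "F ^ ?N" ?q]
      var_power R_hom w_less hom_poly_power[OF F_hom] q by simp
  moreover have "(\<Sum>j<n. d - w j) + ?s = n * d"
    using w_less by (simp add: sum.distrib[symmetric] less_imp_le)
  ultimately show ?thesis by (simp add: distrib_right)
qed

lemma nu_sequence_nu: "nu_sequence p n (real (\<Sum>i<n. w i) / real d) (nu p)"
proof
  let ?s = "\<Sum>i<n. w i"
  have d: "d > 0" using n_pos w_less by fastforce
  have pp: "p > 0" using p prime_gt_0_nat by blast
  show "prime p" by (rule p)
  show "nu p 0 = 0" using in_iff_gt_nu[of 1 0] F_in_frob_ideal_1 by simp
  show "nu p e < p ^ e" for e using in_iff_gt_nu F_power_in by blast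
  show "real (nu p e) \<le> (real (p ^ e) - 1) * (real ?s / real d)" for e
  proof -
    have "\<not> nu p e * d > (p ^ e - 1) * ?s"
      using hom_poly_power_in_frob_ideal[OF F_hom, of "p ^ e" "nu p e" p] notin_iff_le_nu[of "nu p e" e] by auto
    then have "real (nu p e * d) \<le> real ((p ^ e - 1) * ?s)" using of_nat_le_iff not_le by blast
    then show ?thesis using d pp by (simp add: le_divide_eq of_nat_diff)
  qed
  show "p ^ e * nu p e' + nu p e \<le> nu p (e + e')" for e e'
  proof (rule ccontr)
    assume "\<not> ?thesis"
    then have "F ^ (p ^ e * nu p e' + nu p e) \<in> frob_ideal p (p ^ e * p ^ e')"
      using in_iff_gt_nu[of "p ^ e * nu p e' + nu p e" "e + e'"] by (simp add: power_add)
    then have "(F ^ nu p e') ^ (p ^ e) * F ^ nu p e \<in> frob_ideal p (p ^ e * p ^ e')"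
      by (simp add: power_add power_mult[symmetric] mult.commute)
    then have "F ^ nu p e' \<in> frob_ideal p (p ^ e')"
      using frob_ideal_cancel_frobenius[OF p(1) refl] notin_iff_le_nu by blast
    then show False by (simp add: in_iff_gt_nu)
  qed
  have step: "F ^ (p * k) \<in> frob_ideal p (p ^ Suc e) \<longleftrightarrow> F ^ k \<in> frob_ideal p (p ^ e)" for k e
    using frob_ideal_power_iff[OF p(1), of p 1 "F ^ k" "p ^ e"] by (simp add: power_mult[symmetric] mult.commute)
  show "nu p (Suc e) + 1 \<le> p * (nu p e + 1)" for e
    using step[of "nu p e + 1" e] unfolding in_iff_gt_nu by simp
  show "p * (nu p e + 1) \<le> nu p (Suc e) + 1" if dvd: "p dvd nu p (Suc e) + 1" for e
  proof -
    obtain k where k: "nu p (Suc e) + 1 = p * k" using dvd unfolding dvd_def by blast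
    then have "nu p e < k" using step[of k e] unfolding in_iff_gt_nu by linarith
    then show ?thesis unfolding k by (intro mult_le_mono2) simp
  qed
  show "(real (p ^ e) + 1) * (real ?s / real d) \<le> real (nu p e) + real n"
    if "e > 0" "\<not> p dvd nu p e + 1" for e
  proof -
    have "real ((p ^ e + 1) * ?s) \<le> real ((nu p e + n) * d)" using drop_bound[OF that] of_nat_le_iff by blast
    then show ?thesis using d by (simp add: divide_le_eq distrib_right)
  qed
qed

end

end

section \<open>Comparison with polynomial rings over a carrier\<close>

definition vars_below :: "nat \<Rightarrow> 'a::zero mpoly \<Rightarrow> bool" where
  "vars_below n P \<longleftrightarrow> (\<forall>m. mcoeff P m \<noteq> 0 \<longrightarrow> set_mset m \<subseteq> {..<n})"

lemma vars_below_add: "vars_below n P \<Longrightarrow> vars_below n Q \<Longrightarrow> vars_below n (P + Q)"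
  unfolding vars_below_def lookup_add by (metis add.right_neutral)

lemma vars_below_uminus: "vars_below n P \<Longrightarrow> vars_below n (- P :: 'a::ab_group_add mpoly)"
  by (auto simp: vars_below_def)

lemma vars_below_mult: "vars_below n P \<Longrightarrow> vars_below n Q \<Longrightarrow> vars_below n (P * Q :: 'a::comm_ring_1 mpoly)"
  unfolding vars_below_def by (metis Un_least mcoeff_mult_nonzeroE set_mset_union)

lemma vars_below_sum: "(\<And>i. i \<in> A \<Longrightarrow> vars_below n (f i)) \<Longrightarrow> vars_below n (sum f A)"
  by (induction A rule: infinite_finite_induct) (auto simp: vars_below_add, auto simp: vars_below_def)

lemma vars_below_mterm: "set_mset m \<subseteq> {..<n} \<Longrightarrow> vars_below n (mterm m c)"
  by (auto simp: vars_below_def lookup_single when_def)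

lemma vars_below_one: "vars_below n (1 :: 'a::comm_ring_1 mpoly)"
  by (auto simp: vars_below_def lookup_one when_def)

lemma vars_below_power: "vars_below n P \<Longrightarrow> vars_below n (P ^ k :: 'a::comm_ring_1 mpoly)"
  by (induction k) (auto intro: vars_below_mult vars_below_one)

lemma vars_below_pdiff: "vars_below n P \<Longrightarrow> vars_below n (pdiff i P)"
  unfolding vars_below_def mcoeff_pdiff by (metis insert_subset mult_zero_right set_mset_add_mset_insert)

lemma mcoeff_var_power_sum_below:
  assumes "below q m"
  shows "mcoeff (\<Sum>j<n. r j * mterm (replicate_mset q j) 1) m = (0 :: 'a::comm_ring_1)"
proof -
  have "mcoeff (r j * mterm (replicate_mset q j) 1) m = 0" for j
  proof -
    have "\<not> replicate_mset q j \<subseteq># m"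
      using assms by (auto simp: below_def not_le simp flip: count_le_replicate_mset_subset_eq)
    then show ?thesis by (simp add: mult.commute[of "r j"] mcoeff_term_mult)
  qed
  then show ?thesis by (simp add: lookup_sum)
qed

text \<open>
  A surjective homomorphism \<open>\<phi>\<close> from a ring given by a type onto a ring given by a carrier, with a section \<open>\<psi>\<close>.
  It serves both for the identity of the rationals and for the reduction of integers modulo \<open>p\<close>.
\<close>

locale coeff_hom = cring R for R :: "('b, 'c) ring_scheme" (structure) +
  fixes \<phi> :: "'a::comm_ring_1 \<Rightarrow> 'b" and \<psi> :: "'b \<Rightarrow> 'a"
  assumes \<phi>_closed [simp]: "\<phi> x \<in> carrier R"
    and \<phi>_add: "\<phi> (x + y) = \<phi> x \<oplus> \<phi> y"
    and \<phi>_mult: "\<phi> (x * y) = \<phi> x \<otimes> \<phi> y"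
    and \<phi>_one [simp]: "\<phi> 1 = \<one>"
    and \<psi>_zero: "\<psi> \<zero> = 0"
    and \<phi>_\<psi>: "b \<in> carrier R \<Longrightarrow> \<phi> (\<psi> b) = b"
begin

lemma \<phi>_zero [simp]: "\<phi> 0 = \<zero>"
  using \<phi>_\<psi>[of \<zero>] by (simp add: \<psi>_zero)

lemma \<phi>_sum: "\<phi> (sum f A) = (\<Oplus>x\<in>A. \<phi> (f x))"
proof (induction A rule: infinite_finite_induct)
  case (insert x A)
  then show ?case by (subst add.finprod_insert) (auto simp: \<phi>_add)
next
  case (infinite A)
  then show ?case by (simp add: finsum_infinite)
qed auto

definition to_mpoly :: "'a mpoly \<Rightarrow> nat multiset \<Rightarrow> 'b" where
  "to_mpoly P = (\<lambda>m. \<phi> (mcoeff P m))"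

context
  fixes n :: nat and M
  defines "M \<equiv> mpoly_ring R n"
begin

lemma carrier_iff:
  "g \<in> carrier M \<longleftrightarrow> (\<forall>m. g m \<in> carrier R) \<and> finite {m. g m \<noteq> \<zero>} \<and> (\<forall>m. g m \<noteq> \<zero> \<longrightarrow> set_mset m \<subseteq> {..<n})"
  unfolding M_def mpoly_ring_def by (simp add: indexed_pset_iff carrier_coeff_def)

lemma cring_M: "cring M"
  unfolding M_def by (rule cring_mpoly_ring)

lemma to_mpoly_closed:
  assumes "vars_below n P"
  shows "to_mpoly P \<in> carrier M"
proof -
  have "{m. to_mpoly P m \<noteq> \<zero>} \<subseteq> Poly_Mapping.keys P" by (auto simp: to_mpoly_def in_keys_iff)
  then have "finite {m. to_mpoly P m \<noteq> \<zero>}" by (rule finite_subset) simp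
  moreover have "set_mset m \<subseteq> {..<n}" if "to_mpoly P m \<noteq> \<zero>" for m
  proof -
    have "mcoeff P m \<noteq> 0" using that by (auto simp: to_mpoly_def)
    then show ?thesis using assms by (simp add: vars_below_def)
  qed
  ultimately show ?thesis unfolding carrier_iff by (simp add: to_mpoly_def)
qed

lemma to_mpoly_surj:
  assumes "g \<in> carrier M"
  obtains P where "vars_below n P" "to_mpoly P = g" "mcoeff P = \<psi> \<circ> g"
proof -
  have "{m. (\<psi> \<circ> g) m \<noteq> 0} \<subseteq> {m. g m \<noteq> \<zero>}" by (auto simp: \<psi>_zero)
  then have "finite {m. (\<psi> \<circ> g) m \<noteq> 0}" using assms unfolding carrier_iff by (blast intro: finite_subset)
  then have lk: "mcoeff (Abs_poly_mapping (\<psi> \<circ> g)) = \<psi> \<circ> g" by (simp add: Abs_poly_mapping_inverse)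
  have "vars_below n (Abs_poly_mapping (\<psi> \<circ> g))"
    using assms unfolding carrier_iff vars_below_def lk by (metis \<psi>_zero comp_apply)
  moreover have "to_mpoly (Abs_poly_mapping (\<psi> \<circ> g)) = g"
    using assms unfolding carrier_iff by (auto simp: to_mpoly_def lk \<phi>_\<psi>)
  ultimately show ?thesis using that lk by blast
qed

lemma to_mpoly_add: "to_mpoly (P + Q) = to_mpoly P \<oplus>\<^bsub>M\<^esub> to_mpoly Q"
  by (auto simp: M_def mpoly_ring_def to_mpoly_def indexed_padd_def lookup_add \<phi>_add)

lemma to_mpoly_mult: "to_mpoly (P * Q) = to_mpoly P \<otimes>\<^bsub>M\<^esub> to_mpoly Q"
  by (auto simp: M_def mpoly_ring_def to_mpoly_def mcoeff_mult \<phi>_sum \<phi>_mult)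

lemma to_mpoly_zero: "to_mpoly 0 = \<zero>\<^bsub>M\<^esub>"
  by (auto simp: M_def mpoly_ring_def to_mpoly_def indexed_const_def)

lemma to_mpoly_one: "to_mpoly 1 = \<one>\<^bsub>M\<^esub>"
  by (auto simp: M_def mpoly_ring_def to_mpoly_def indexed_const_def lookup_one when_def)

lemma to_mpoly_power: "to_mpoly (P ^ k) = to_mpoly P [^]\<^bsub>M\<^esub> k"
proof (induction k)
  case (Suc k)
  then show ?case by (simp add: to_mpoly_mult power_Suc2 del: power_Suc)
qed (simp add: to_mpoly_one)

lemma to_mpoly_var: "to_mpoly (mterm {#i#} 1) = indexed_var i"
  by (auto simp: to_mpoly_def indexed_var_def indexed_pmult_def indexed_const_def lookup_single when_def
      fun_eq_iff dest!: multi_member_split)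

lemma to_mpoly_var_power: "to_mpoly (mterm (replicate_mset k i) 1) = indexed_var i [^]\<^bsub>M\<^esub> k"
  using to_mpoly_power[of "mterm {#i#} 1" k] by (simp add: to_mpoly_var mterm_power)

lemma to_mpoly_pdiff: "to_mpoly (pdiff i P) = mpoly_deriv R i (to_mpoly P)"
proof -
  have "\<phi> (of_nat k * x) = [k] \<cdot> \<phi> x" for k x
    by (induction k) (auto simp: algebra_simps \<phi>_add add.m_comm)
  then show ?thesis by (simp add: to_mpoly_def mpoly_deriv_def mcoeff_pdiff fun_eq_iff del: of_nat_Suc)
qed

text \<open>
  The combinations on the right form an ideal, and surjectivity of \<open>to_mpoly\<close> is what makes them closed
  under multiplication by arbitrary ring elements.
\<close>

lemma genideal_to_mpoly:
  assumes g: "\<And>j. j < n \<Longrightarrow> vars_below n (g j)"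
  shows "genideal M ((\<lambda>j. to_mpoly (g j)) ` {..<n}) =
     {to_mpoly (\<Sum>j<n. r j * g j) | r. \<forall>j<n. vars_below n (r j)}" (is "?I = ?J")
proof
  interpret M: cring M by (rule cring_M)
  have gens: "(\<lambda>j. to_mpoly (g j)) ` {..<n} \<subseteq> carrier M" using g to_mpoly_closed by auto
  have JM: "?J \<subseteq> carrier M"
    using g by (auto intro!: to_mpoly_closed vars_below_sum vars_below_mult)
  show "?I \<subseteq> ?J"
  proof (rule M.genideal_minimal)
    show "(\<lambda>j. to_mpoly (g j)) ` {..<n} \<subseteq> ?J"
    proof safe
      fix j assume j: "j < n"
      let ?r = "\<lambda>k. if k = j then 1 else (0::'a mpoly)"
      have "(\<Sum>k<n. ?r k * g k) = (\<Sum>k<n. if k = j then g j else 0)" by (intro sum.cong) auto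
      then have "(\<Sum>k<n. ?r k * g k) = g j" using j by simp
      moreover have "\<forall>k<n. vars_below n (?r k)" by (auto simp: vars_below_one, auto simp: vars_below_def)
      ultimately show "\<exists>r. to_mpoly (g j) = to_mpoly (\<Sum>j<n. r j * g j) \<and> (\<forall>j<n. vars_below n (r j))"
        by (intro exI[of _ ?r]) auto
    qed
    show "ideal ?J M"
    proof (rule idealI)
      show "ring M" by (rule M.ring_axioms)
      show "subgroup ?J (add_monoid M)"
      proof (rule group.subgroupI)
        show "group (add_monoid M)" by (rule M.a_group)
        show "?J \<subseteq> carrier (add_monoid M)" using JM by simp
        have "to_mpoly (\<Sum>j<n. 0 * g j) \<in> ?J" by (intro CollectI exI[of _ "\<lambda>_. 0"]) (auto simp: vars_below_def)
        then show "?J \<noteq> {}" by blast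
      next
        fix a assume "a \<in> ?J"
        then obtain r where r: "a = to_mpoly (\<Sum>j<n. r j * g j)" "\<forall>j<n. vars_below n (r j)" by blast
        have "to_mpoly (\<Sum>j<n. (- r j) * g j) \<oplus>\<^bsub>M\<^esub> a = \<zero>\<^bsub>M\<^esub>"
          unfolding r to_mpoly_add[symmetric] by (simp add: sum_negf to_mpoly_zero)
        moreover have "to_mpoly (\<Sum>j<n. (- r j) * g j) \<in> carrier M"
          using r g by (intro to_mpoly_closed vars_below_sum vars_below_mult vars_below_uminus) auto
        ultimately have "\<ominus>\<^bsub>M\<^esub> a = to_mpoly (\<Sum>j<n. (- r j) * g j)"
          using JM \<open>a \<in> ?J\<close> by (intro M.minus_equality) auto
        then show "inv\<^bsub>add_monoid M\<^esub> a \<in> ?J"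
          using r vars_below_uminus unfolding a_inv_def[symmetric] by (intro CollectI exI[of _ "\<lambda>j. - r j"]) auto
      next
        fix a b assume "a \<in> ?J" "b \<in> ?J"
        then obtain r s where r: "a = to_mpoly (\<Sum>j<n. r j * g j)" "\<forall>j<n. vars_below n (r j)"
          and s: "b = to_mpoly (\<Sum>j<n. s j * g j)" "\<forall>j<n. vars_below n (s j)" by blast
        have "a \<oplus>\<^bsub>M\<^esub> b = to_mpoly (\<Sum>j<n. (r j + s j) * g j)"
          unfolding r s to_mpoly_add[symmetric] by (simp add: distrib_right sum.distrib)
        then show "a \<otimes>\<^bsub>add_monoid M\<^esub> b \<in> ?J"
          using r s by (intro CollectI exI[of _ "\<lambda>j. r j + s j"]) (auto intro: vars_below_add)
      qed
      fix a x assume a: "a \<in> ?J" and x: "x \<in> carrier M"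
      then obtain r where r: "a = to_mpoly (\<Sum>j<n. r j * g j)" "\<forall>j<n. vars_below n (r j)" by blast
      obtain Y where Y: "vars_below n Y" "to_mpoly Y = x" using x by (rule to_mpoly_surj)
      have "x \<otimes>\<^bsub>M\<^esub> a = to_mpoly (\<Sum>j<n. (Y * r j) * g j)"
        unfolding r Y(2)[symmetric] to_mpoly_mult[symmetric] by (simp add: sum_distrib_left mult.assoc)
      then show *: "x \<otimes>\<^bsub>M\<^esub> a \<in> ?J"
        using r Y vars_below_mult by (intro CollectI exI[of _ "\<lambda>j. Y * r j"]) auto
      have "a \<in> carrier M" using JM a by (rule subsetD)
      then have "a \<otimes>\<^bsub>M\<^esub> x = x \<otimes>\<^bsub>M\<^esub> a" using x by (rule M.m_comm)
      then show "a \<otimes>\<^bsub>M\<^esub> x \<in> ?J" using * by (simp only:)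
    qed
  qed
  show "?J \<subseteq> ?I"
  proof safe
    fix r :: "nat \<Rightarrow> 'a mpoly" assume r: "\<forall>j<n. vars_below n (r j)"
    interpret I: ideal ?I M by (rule M.genideal_ideal[OF gens])
    have "to_mpoly (\<Sum>j\<in>A. r j * g j) \<in> ?I" if "A \<subseteq> {..<n}" for A
      using finite_subset[OF that finite_lessThan] that
    proof (induction A rule: finite_induct)
      case empty
      then show ?case using I.zero_closed by (simp add: to_mpoly_zero)
    next
      case (insert j A)
      have "to_mpoly (g j) \<in> ?I" using M.genideal_self[OF gens] insert.prems by auto
      then have "to_mpoly (r j) \<otimes>\<^bsub>M\<^esub> to_mpoly (g j) \<in> ?I"
        using r insert.prems by (intro I.I_l_closed to_mpoly_closed) auto
      then show ?case using insert by (auto simp: to_mpoly_add to_mpoly_mult intro!: I.a_closed)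
    qed
    then show "to_mpoly (\<Sum>j<n. r j * g j) \<in> ?I" by blast
  qed
qed

lemma var_power_ideal_eq:
  "var_power_ideal R n q = {to_mpoly (\<Sum>j<n. r j * mterm (replicate_mset q j) 1) | r. \<forall>j<n. vars_below n (r j)}"
proof -
  have "var_power_ideal R n q = genideal M ((\<lambda>j. to_mpoly (mterm (replicate_mset q j) 1)) ` {..<n})"
    by (simp add: var_power_ideal_def M_def to_mpoly_var_power[unfolded M_def])
  moreover have "set_mset (replicate_mset q j) \<subseteq> {..<n}" if "j < n" for j
    using that by (auto split: if_splits)
  ultimately show ?thesis by (simp add: genideal_to_mpoly vars_below_mterm)
qed

text \<open>
  For the nontrivial direction, each monomial with an exponent at least \<open>q\<close> is assigned to one variable whose
  \<open>q\<close>-th power divides it; collecting the terms by variable gives the cofactors.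
\<close>

lemma to_mpoly_in_var_power_ideal_iff:
  assumes P: "vars_below n P" and q: "q > 0"
  shows "to_mpoly P \<in> var_power_ideal R n q \<longleftrightarrow> (\<forall>m. below q m \<longrightarrow> \<phi> (mcoeff P m) = \<zero>)"
proof -
  have eq_iff: "to_mpoly P = to_mpoly Q \<longleftrightarrow> (\<forall>m. \<phi> (mcoeff P m) = \<phi> (mcoeff Q m))" for P Q
    by (auto simp: to_mpoly_def fun_eq_iff)
  show ?thesis
  proof
    assume "to_mpoly P \<in> var_power_ideal R n q"
    then obtain r where "to_mpoly P = to_mpoly (\<Sum>j<n. r j * mterm (replicate_mset q j) 1)"
      unfolding var_power_ideal_eq by blast
    then have "\<phi> (mcoeff P m) = \<zero>" if "below q m" for m
      using mcoeff_var_power_sum_below[OF that, where n = n and r = r] unfolding eq_iff by simp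
    then show "\<forall>m. below q m \<longrightarrow> \<phi> (mcoeff P m) = \<zero>" by blast
  next
    assume P_in: "\<forall>m. below q m \<longrightarrow> \<phi> (mcoeff P m) = \<zero>"
    define J where "J m = (LEAST j. q \<le> count m j)" for m :: "nat multiset"
    let ?S = "{m \<in> Poly_Mapping.keys P. \<not> below q m}"
    have J: "J m < n" "replicate_mset q (J m) \<subseteq># m" if "m \<in> ?S" for m
    proof -
      have "\<exists>j. q \<le> count m j" using that by (auto simp: below_def not_less)
      then have *: "q \<le> count m (J m)" unfolding J_def by (rule LeastI_ex)
      then show "replicate_mset q (J m) \<subseteq># m" by (simp add: count_le_replicate_mset_subset_eq)
      have "J m \<in># m" using * q by (metis count_eq_zero_iff leD)
      moreover have "set_mset m \<subseteq> {..<n}" using P that by (auto simp: vars_below_def in_keys_iff)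
      ultimately show "J m < n" by auto
    qed
    define r where "r j = (\<Sum>m | m \<in> ?S \<and> J m = j. mterm (m - replicate_mset q j) (mcoeff P m))" for j
    have fin: "finite ?S" by simp
    have r_vars: "vars_below n (r j)" for j
    proof -
      have "set_mset (m - replicate_mset q j) \<subseteq> {..<n}" if "m \<in> ?S" for m
        using P that set_mset_mono[OF diff_subset_eq_self, of m "replicate_mset q j"]
        unfolding vars_below_def in_keys_iff by blast
      then show ?thesis unfolding r_def by (intro vars_below_sum vars_below_mterm) auto
    qed
    have "(\<Sum>j<n. r j * mterm (replicate_mset q j) 1)
        = (\<Sum>j<n. \<Sum>m | m \<in> ?S \<and> J m = j. mterm m (mcoeff P m))"
      unfolding r_def sum_distrib_right
    proof (intro sum.cong refl)
      fix j m assume "m \<in> {m \<in> ?S. J m = j}"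
      then have "replicate_mset q j \<subseteq># m" using J(2) by auto
      then show "mterm (m - replicate_mset q j) (mcoeff P m) * mterm (replicate_mset q j) 1 = mterm m (mcoeff P m)"
        by (simp add: mult_single subset_mset.diff_add)
    qed
    also have "\<dots> = (\<Sum>m\<in>?S. mterm m (mcoeff P m))"
      by (rule sum.group[OF fin]) (use J in auto)
    finally have sum_eq: "(\<Sum>j<n. r j * mterm (replicate_mset q j) 1) = (\<Sum>m\<in>?S. mterm m (mcoeff P m))" .
    have "mcoeff (\<Sum>m\<in>?S. mterm m (mcoeff P m)) k = (if below q k then 0 else mcoeff P k)" for k
    proof -
      have "mcoeff (\<Sum>m\<in>?S. mterm m (mcoeff P m)) k = (\<Sum>m\<in>?S. if m = k then mcoeff P k else 0)"
        unfolding lookup_sum by (intro sum.cong) (auto simp: lookup_single when_def)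
      then show ?thesis using fin by (auto simp: in_keys_iff)
    qed
    then have "to_mpoly P = to_mpoly (\<Sum>j<n. r j * mterm (replicate_mset q j) 1)"
      using P_in unfolding eq_iff sum_eq by auto
    then show "to_mpoly P \<in> var_power_ideal R n q" unfolding var_power_ideal_eq using r_vars by blast
  qed
qed

lemma to_mpoly_in_maximal_ideal_iff:
  assumes "vars_below n P"
  shows "to_mpoly P \<in> maximal_ideal_origin R n \<longleftrightarrow> \<phi> (mcoeff P {#}) = \<zero>"
proof -
  interpret M: cring M by (rule cring_M)
  have "maximal_ideal_origin R n = var_power_ideal R n 1"
    using to_mpoly_closed[OF vars_below_mterm, of "{#_#}" 1] unfolding maximal_ideal_origin_def var_power_ideal_def
    by (intro arg_cong[where f = "genideal (mpoly_ring R n)"] image_cong refl)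
       (simp add: to_mpoly_var M_def[symmetric])
  moreover have "below 1 m \<longleftrightarrow> m = {#}" for m by (auto simp: below_def multiset_eq_iff)
  ultimately show ?thesis using to_mpoly_in_var_power_ideal_iff[OF assms, of 1] by simp
qed

lemma jacobian_ideal_eq:
  assumes "vars_below n P"
  shows "jacobian_ideal R n (to_mpoly P) = {to_mpoly (\<Sum>j<n. r j * pdiff j P) | r. \<forall>j<n. vars_below n (r j)}"
proof -
  have "jacobian_ideal R n (to_mpoly P) = genideal M ((\<lambda>j. to_mpoly (pdiff j P)) ` {..<n})"
    by (simp add: jacobian_ideal_def M_def to_mpoly_pdiff)
  then show ?thesis by (simp add: genideal_to_mpoly vars_below_pdiff assms)
qed

end

end

section \<open>Reduction modulo a prime\<close>

lemma residue_coeff_hom: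
  assumes "prime p"
  shows "coeff_hom (FF p) (\<lambda>z. z mod int p) (\<lambda>z. z)"
proof -
  interpret residues "int p" "FF p" using prime_gt_1_nat[OF assms] by unfold_locales auto
  show ?thesis
    using prime_gt_1_nat[OF assms]
    by unfold_locales (auto simp: res_carrier_eq res_add_eq res_mult_eq res_zero_eq res_one_eq mod_simps)
qed

lemma to_mpoly_mod_in_var_power_ideal_iff:
  assumes p: "prime p" and P: "vars_below n P" and q: "q > 0"
  shows "coeff_hom.to_mpoly (\<lambda>z. z mod int p) P \<in> var_power_ideal (FF p) n q \<longleftrightarrow> P \<in> frob_ideal p q"
proof -
  interpret coeff_hom "FF p" "\<lambda>z. z mod int p" "\<lambda>z. z" by (rule residue_coeff_hom[OF p])
  have "\<zero>\<^bsub>FF p\<^esub> = 0" by (simp add: residue_ring_def)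
  then show ?thesis unfolding to_mpoly_in_var_power_ideal_iff[OF P q] by (simp add: frob_ideal_def dvd_eq_mod_eq_0)
qed

text \<open>
  As \<open>c\<close> clears the denominator of \<open>r\<close>, that denominator divides \<open>c\<close> and is therefore invertible modulo \<open>p\<close>.
\<close>

lemma rat_mod_cong:
  assumes p: "prime p" and c: "\<not> int p dvd c" and z: "of_int c * r = of_int z"
  shows "[c * rat_mod p r = z] (mod int p)"
proof -
  obtain a b where ab: "quotient_of r = (a, b)" by (cases "quotient_of r")
  then have b: "b > 0" "coprime a b" "r = of_int a / of_int b"
    using quotient_of_denom_pos quotient_of_coprime quotient_of_div by blast+
  have "(of_int (c * a) :: rat) = of_int (z * b)" using z b by (simp add: field_simps)
  then have ca: "c * a = z * b" by (simp only: of_int_eq_iff)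
  then have "b dvd c" using b(2) by (metis coprime_commute coprime_dvd_mult_left_iff dvd_triv_right)
  then have pb: "\<not> int p dvd b" using c dvd_trans by blast
  interpret residues_prime p "FF p" by unfold_locales (rule p)
  let ?i = "inv\<^bsub>FF p\<^esub> (b mod int p)"
  have "b mod int p \<noteq> 0" using pb by (simp add: dvd_eq_mod_eq_0)
  moreover have "0 \<le> b mod int p" "b mod int p < int p" using prime_gt_0_nat[OF p] by simp_all
  ultimately have "b mod int p \<in> Units (FF p)" unfolding res_prime_units_eq by simp
  then have "(b mod int p) \<otimes>\<^bsub>FF p\<^esub> ?i = \<one>\<^bsub>FF p\<^esub>" by (rule Units_r_inv)
  then have bi: "[b * ?i = 1] (mod int p)"
    using prime_gt_1_nat[OF p] by (simp add: res_mult_eq res_one_eq cong_def mod_simps)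
  have "rat_mod p r = (a mod int p * ?i) mod int p" by (simp add: rat_mod_def ab res_mult_eq)
  then have "[c * rat_mod p r = c * (a * ?i)] (mod int p)" by (simp add: cong_def mod_simps)
  also have "c * (a * ?i) = z * (b * ?i)" using ca by (simp add: mult.assoc[symmetric])
  also have "[z * (b * ?i) = z * 1] (mod int p)" by (intro cong_mult cong_refl bi)
  finally show ?thesis by simp
qed

section \<open>Integral models\<close>

lemma rat_coeff_hom: "coeff_hom QQ id id"
proof -
  interpret cring QQ by (rule cring_from_type_algebra)
  show ?thesis by unfold_locales (auto simp: ring_of_type_algebra_def)
qed

lemma common_denominator:
  fixes S :: "rat set"
  assumes "finite S"
  shows "\<exists>c::int. c > 0 \<and> (\<forall>x\<in>S. of_int c * x \<in> \<int>)"
  using assms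
proof (induction S rule: finite_induct)
  case empty
  then show ?case by (intro exI[of _ 1]) auto
next
  case (insert x S)
  then obtain c :: int where c: "c > 0" "\<forall>x\<in>S. of_int c * x \<in> \<int>" by blast
  obtain a b where ab: "quotient_of x = (a, b)" by (cases "quotient_of x")
  then have b: "b > 0" "x = of_int a / of_int b"
    using quotient_of_denom_pos quotient_of_div by blast+
  have "of_int (b * c) * x \<in> \<int>"
  proof -
    have "of_int (b * c) * x = of_int (c * a)" using b by simp
    then show ?thesis by (metis Ints_of_int)
  qed
  moreover have "of_int (b * c) * y \<in> \<int>" if "y \<in> S" for y
  proof -
    have "of_int (b * c) * y = of_int b * (of_int c * y)" by simp
    then show ?thesis using c(2) that by (metis Ints_mult Ints_of_int)
  qed
  ultimately show ?case using b(1) c(1) by (intro exI[of _ "b * c"]) auto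
qed

definition clear_denominators :: "int \<Rightarrow> rat mpoly \<Rightarrow> int mpoly" where
  "clear_denominators c P = Poly_Mapping.map (\<lambda>x. \<lfloor>of_int c * x\<rfloor>) P"

lemma mcoeff_clear_denominators:
  assumes "\<And>m. m \<in> Poly_Mapping.keys P \<Longrightarrow> of_int c * mcoeff P m \<in> \<int>"
  shows "of_int (mcoeff (clear_denominators c P) m) = of_int c * mcoeff P m"
  using assms[of m] unfolding clear_denominators_def
  by (cases "m \<in> Poly_Mapping.keys P") (auto simp: map.rep_eq in_keys_iff when_def)

definition restriction :: "nat multiset set \<Rightarrow> 'a::zero mpoly \<Rightarrow> 'a mpoly" where
  "restriction S P = Abs_poly_mapping (\<lambda>m. if m \<in> S then mcoeff P m else 0)"

lemma mcoeff_restriction: "mcoeff (restriction S P) m = (if m \<in> S then mcoeff P m else 0)"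
proof -
  let ?h = "\<lambda>m. if m \<in> S then mcoeff P m else 0"
  have "{m. ?h m \<noteq> 0} \<subseteq> Poly_Mapping.keys P" by (auto simp: in_keys_iff)
  then have "finite {m. ?h m \<noteq> 0}" by (rule finite_subset) simp
  then show ?thesis by (simp add: restriction_def Abs_poly_mapping_inverse)
qed

text \<open>
  What the equality of the radical of the Jacobian ideal with the maximal ideal means for polynomials:
  no derivative has a constant term, and some power, the same for all variables, of each variable lies in the Jacobian ideal.
\<close>

lemma isolated_singularity_var_powers:
  fixes P :: "rat mpoly"
  assumes iso: "isolated_singularity_origin QQ n (mcoeff P)" and P: "vars_below n P"
  shows "j < n \<Longrightarrow> mcoeff (pdiff j P) {#} = 0"
    and "\<exists>K r. \<forall>i<n. mterm (replicate_mset K i) 1 = (\<Sum>j<n. r i j * pdiff j P) \<and> (\<forall>j<n. vars_below n (r i j))"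
proof -
  interpret coeff_hom QQ id id by (rule rat_coeff_hom)
  have zero: "\<zero>\<^bsub>QQ\<^esub> = (0 :: rat)" by (simp add: ring_of_type_algebra_def)
  let ?M = "mpoly_ring QQ n"
  interpret M: cring ?M by (rule cring_M)
  have im: "to_mpoly P = mcoeff P" for P by (simp add: to_mpoly_def)
  note jac = jacobian_ideal_eq[OF P, unfolded im]
  have rad: "g \<in> maximal_ideal_origin QQ n \<longleftrightarrow> g \<in> carrier ?M \<and> (\<exists>k::nat. g [^]\<^bsub>?M\<^esub> k \<in> jacobian_ideal QQ n (mcoeff P))" for g
    using iso unfolding isolated_singularity_origin_def ideal_radical_def by auto
  show "mcoeff (pdiff j P) {#} = 0" if j: "j < n"
  proof -
    have c: "mcoeff (pdiff j P) \<in> carrier ?M" using to_mpoly_closed[OF vars_below_pdiff[OF P]] by (simp add: im)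
    have "(\<Sum>k<n. (if k = j then 1 else 0) * pdiff k P) = (\<Sum>k<n. if k = j then pdiff j P else 0)"
      by (intro sum.cong) auto
    then have "(\<Sum>k<n. (if k = j then 1 else 0) * pdiff k P) = pdiff j P" using j by simp
    moreover have "\<forall>k<n. vars_below n (if k = j then 1 else (0 :: rat mpoly))"
      by (auto simp: vars_below_one, auto simp: vars_below_def)
    ultimately have "mcoeff (pdiff j P) \<in> jacobian_ideal QQ n (mcoeff P)"
      unfolding jac by (intro CollectI exI[of _ "\<lambda>k. if k = j then 1 else 0"]) auto
    moreover have "mcoeff (pdiff j P) [^]\<^bsub>?M\<^esub> (1::nat) = mcoeff (pdiff j P)" using c by simp
    ultimately have "to_mpoly (pdiff j P) \<in> maximal_ideal_origin QQ n" unfolding rad im using c by metis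
    then show ?thesis using to_mpoly_in_maximal_ideal_iff[OF vars_below_pdiff[OF P]] zero by simp
  qed
  have "\<exists>k r. mterm (replicate_mset k i) 1 = (\<Sum>j<n. r j * pdiff j P) \<and> (\<forall>j<n. vars_below n (r j))" if i: "i < n" for i
  proof -
    have "to_mpoly (mterm {#i#} 1) \<in> maximal_ideal_origin QQ n"
      using i by (subst to_mpoly_in_maximal_ideal_iff) (auto simp: vars_below_mterm zero lookup_single)
    then obtain k :: nat where k: "to_mpoly (mterm {#i#} 1) [^]\<^bsub>?M\<^esub> k \<in> jacobian_ideal QQ n (mcoeff P)"
      unfolding rad by blast
    have "to_mpoly (mterm (replicate_mset k i) 1) \<in> jacobian_ideal QQ n (mcoeff P)"
      using k by (simp only: to_mpoly_var to_mpoly_var_power[where n = n])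
    then have "mcoeff (mterm (replicate_mset k i) (1::rat)) \<in> jacobian_ideal QQ n (mcoeff P)" unfolding im .
    then obtain r where "mcoeff (mterm (replicate_mset k i) 1) = mcoeff (\<Sum>j<n. r j * pdiff j P)" "\<forall>j<n. vars_below n (r j)"
      unfolding jac by blast
    then show ?thesis by (metis poly_mapping_eqI)
  qed
  then have "\<forall>i\<in>{..<n}. \<exists>kr. mterm (replicate_mset (fst kr) i) 1 = (\<Sum>j<n. snd kr j * pdiff j P)
      \<and> (\<forall>j<n. vars_below n (snd kr j))" by simp
  from bchoice[OF this] obtain kr where
    "\<forall>i\<in>{..<n}. mterm (replicate_mset (fst (kr i)) i) 1 = (\<Sum>j<n. snd (kr i) j * pdiff j P)
      \<and> (\<forall>j<n. vars_below n (snd (kr i) j))" by (rule exE)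
  moreover define k r where "k i = fst (kr i)" and "r i = snd (kr i)" for i
  ultimately have kr: "\<And>i. i < n \<Longrightarrow> mterm (replicate_mset (k i) i) 1 = (\<Sum>j<n. r i j * pdiff j P)"
    "\<And>i j. i < n \<Longrightarrow> j < n \<Longrightarrow> vars_below n (r i j)" by simp_all
  define K where "K = (\<Sum>i<n. k i)"
  let ?r = "\<lambda>i j. mterm (replicate_mset (K - k i) i) 1 * r i j"
  have "mterm (replicate_mset K i) 1 = (\<Sum>j<n. ?r i j * pdiff j P)" if i: "i < n" for i
  proof -
    have "k i \<le> K" unfolding K_def using i by (intro member_le_sum) auto
    then have "replicate_mset K i = replicate_mset (K - k i) i + replicate_mset (k i) i"
      by (intro multiset_eqI) simp
    then have "mterm (replicate_mset K i) (1::rat) = mterm (replicate_mset (K - k i) i) 1 * mterm (replicate_mset (k i) i) 1"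
      by (simp add: mult_single)
    then show ?thesis unfolding kr(1)[OF i] by (simp add: sum_distrib_left mult.assoc)
  qed
  moreover have "vars_below n (?r i j)" if "i < n" "j < n" for i j
    using that kr(2) by (intro vars_below_mult vars_below_mterm) (auto split: if_splits)
  ultimately show "\<exists>K r. \<forall>i<n. mterm (replicate_mset K i) 1 = (\<Sum>j<n. r i j * pdiff j P) \<and> (\<forall>j<n. vars_below n (r i j))"
    by (intro exI[of _ K] exI[of _ ?r]) blast
qed

lemma wdeg_pdiff:
  assumes "hom_poly n w d P" "mcoeff (pdiff j P) v \<noteq> 0"
  shows "w j + wdeg w v = d"
proof -
  have "mcoeff P (add_mset j v) \<noteq> 0" using assms(2) by (auto simp: mcoeff_pdiff)
  then have "wdeg w (add_mset j v) = d" using assms(1) unfolding hom_poly_def by blast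
  then show ?thesis by simp
qed

text \<open>
  The cofactors obtained from the radical may be replaced by their components of the degree that homogeneity
  prescribes, and then all denominators are cleared at once. That \<open>w i < d\<close> is a consequence
  of the isolated singularity: since derivatives have no constant term, the relation for a power of \<open>x\<^sub>i\<close> shows
  that the derivative of \<open>f\<close> by some \<open>x\<^sub>j\<close> contains a monomial \<open>x\<^sub>i\<^sup>t\<close> with \<open>t \<ge> 1\<close>, so \<open>d = w j + t w i\<close>.
\<close>

lemma exists_integral_model:
  assumes n: "1 \<le> n" and hi: "homogeneous_isolated n f"
    and w: "\<And>i. i < n \<Longrightarrow> w i > 0" and deg: "\<And>m. f m \<noteq> 0 \<Longrightarrow> (\<Sum>i<n. w i * count m i) = d"
  shows "\<exists>F K c R c0. quasi_homogeneous n w d F K c R \<and> c \<noteq> 0 \<and> c0 \<noteq> 0 \<and> (\<forall>m. of_int (mcoeff F m) = of_int c0 * f m)"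
proof -
  interpret coeff_hom QQ id id by (rule rat_coeff_hom)
  have "f \<in> carrier (mpoly_ring QQ n)" using hi by (simp add: homogeneous_isolated_def)
  then obtain P where P: "vars_below n P" "mcoeff P = f" by (rule to_mpoly_surj) (auto simp: o_def)
  have iso: "isolated_singularity_origin QQ n (mcoeff P)" using hi P by (simp add: homogeneous_isolated_def)
  have hom: "hom_poly n w d P"
    unfolding hom_poly_def using P deg wdeg_eq_sum unfolding vars_below_def by metis
  obtain K r where r: "\<And>i. i < n \<Longrightarrow> mterm (replicate_mset K i) 1 = (\<Sum>j<n. r i j * pdiff j P)"
      "\<And>i j. i < n \<Longrightarrow> j < n \<Longrightarrow> vars_below n (r i j)"
    using isolated_singularity_var_powers(2)[OF iso P(1)] by blast
  have w_less: "w i < d" if i: "i < n" for i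
  proof -
    have "mcoeff (\<Sum>j<n. r i j * pdiff j P) (replicate_mset K i) \<noteq> 0" unfolding r(1)[OF i, symmetric] by simp
    then obtain j where j: "j < n" "mcoeff (r i j * pdiff j P) (replicate_mset K i) \<noteq> 0"
      unfolding lookup_sum by (elim sum.not_neutral_contains_not_neutral) auto
    then obtain u v where uv: "replicate_mset K i = u + v" "mcoeff (pdiff j P) v \<noteq> 0"
      by (elim mcoeff_mult_nonzeroE)
    then have "v \<noteq> {#}" using isolated_singularity_var_powers(1)[OF iso P(1) j(1)] by auto
    moreover have "set_mset v \<subseteq> {i}" using uv(1) by (metis Un_upper2 set_mset_union set_mset_replicate_mset_subset empty_subsetI subset_trans order_refl)
    ultimately obtain v' where "v = add_mset i v'" by (metis multi_member_split multiset_nonemptyE singletonD subsetD)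
    then show ?thesis using wdeg_pdiff[OF hom uv(2)] w[OF j(1)] by simp
  qed
  define h where "h i j = restriction {u. wdeg w u + (d - w j) = K * w i} (r i j)" for i j
  have h: "mcoeff (h i j) u = (if wdeg w u + (d - w j) = K * w i then mcoeff (r i j) u else 0)" for i j u
    by (simp add: h_def mcoeff_restriction)
  have h_rel: "mterm (replicate_mset K i) 1 = (\<Sum>j<n. h i j * pdiff j P)" if i: "i < n" for i
  proof (rule poly_mapping_eqI)
    fix m
    have coeff: "mcoeff (h i j * pdiff j P) m = (if wdeg w m = K * w i then mcoeff (r i j * pdiff j P) m else 0)" if "j < n" for j
    proof -
      have eq: "mcoeff (h i j) u * mcoeff (pdiff j P) (m - u)
          = (if wdeg w m = K * w i then mcoeff (r i j) u * mcoeff (pdiff j P) (m - u) else 0)" if "u \<subseteq># m" for u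
      proof (cases "mcoeff (pdiff j P) (m - u) = 0")
        case False
        have "wdeg w m = wdeg w u + wdeg w (m - u)" using that by (metis subset_mset.add_diff_inverse wdeg_add)
        then have "wdeg w m = wdeg w u + (d - w j)" using wdeg_pdiff[OF hom False] by linarith
        then show ?thesis by (simp add: h)
      qed simp
      show ?thesis unfolding mcoeff_mult using eq by (auto intro!: sum.cong)
    qed
    have "mcoeff (\<Sum>j<n. h i j * pdiff j P) m = (if wdeg w m = K * w i then mcoeff (\<Sum>j<n. r i j * pdiff j P) m else 0)"
      unfolding lookup_sum using coeff by (auto intro!: sum.cong)
    then show "mcoeff (mterm (replicate_mset K i) 1) m = mcoeff (\<Sum>j<n. h i j * pdiff j P) m"
      unfolding r(1)[OF i, symmetric] by (auto simp: lookup_single when_def)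
  qed
  define T where "T = f ` Poly_Mapping.keys P \<union> (\<Union>i<n. \<Union>j<n. mcoeff (h i j) ` Poly_Mapping.keys (h i j))"
  have fin: "finite T" unfolding T_def by (intro finite_UnI finite_imageI finite_keys finite_UN_I finite_lessThan)
  obtain c0 :: int where c0: "c0 > 0" "\<And>x. x \<in> T \<Longrightarrow> of_int c0 * x \<in> \<int>"
    using common_denominator[OF fin] by auto
  define F where "F = clear_denominators c0 P"
  have F: "of_int (mcoeff F m) = of_int c0 * mcoeff P m" for m
    unfolding F_def by (intro mcoeff_clear_denominators c0(2)) (simp add: T_def P(2))
  define R where "R i j = clear_denominators c0 (h i j)" for i j
  have R: "of_int (mcoeff (R i j) m) = of_int c0 * mcoeff (h i j) m" if "i < n" "j < n" for i j m
    unfolding R_def using that by (intro mcoeff_clear_denominators c0(2)) (auto simp: T_def)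
  have pdF: "of_int (mcoeff (pdiff j F) m) = of_int c0 * mcoeff (pdiff j P) m" for j m
    by (simp add: mcoeff_pdiff F)
  have "quasi_homogeneous n w d F K (c0 * c0) R"
  proof
    show "n > 0" using n by simp
    show "i < n \<Longrightarrow> w i < d" for i using w_less by auto
    show "hom_poly n w d F" unfolding hom_poly_def
    proof (intro allI impI)
      fix m assume "mcoeff F m \<noteq> 0"
      then have "of_int c0 * mcoeff P m \<noteq> 0" unfolding F[symmetric] by simp
      then show "set_mset m \<subseteq> {..<n} \<and> wdeg w m = d" using hom unfolding hom_poly_def by auto
    qed
    show "mterm (replicate_mset K i) (c0 * c0) = (\<Sum>j<n. R i j * pdiff j F)" if i: "i < n" for i
    proof (rule poly_mapping_eqI)
      fix m
      have "(of_int (mcoeff (\<Sum>j<n. R i j * pdiff j F) m) :: rat)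
          = of_int (c0 * c0) * mcoeff (\<Sum>j<n. h i j * pdiff j P) m"
        unfolding lookup_sum mcoeff_mult using i
        by (simp add: of_int_sum R pdF sum_distrib_left mult_ac)
      also have "\<dots> = of_int (mcoeff (mterm (replicate_mset K i) (c0 * c0)) m)"
        unfolding h_rel[OF i, symmetric] by (simp add: lookup_single when_def)
      finally show "mcoeff (mterm (replicate_mset K i) (c0 * c0)) m = mcoeff (\<Sum>j<n. R i j * pdiff j F) m"
        by (simp only: of_int_eq_iff)
    qed
    show "set_mset u \<subseteq> {..<n} \<and> wdeg w u + (d - w j) = K * w i"
      if ij: "i < n" "j < n" and nz: "mcoeff (R i j) u \<noteq> 0" for i j u
    proof -
      have "of_int c0 * mcoeff (h i j) u \<noteq> 0" using nz unfolding R[OF ij, symmetric] by simp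
      then have "mcoeff (h i j) u \<noteq> 0" by simp
      then show ?thesis using r(2)[OF ij] unfolding h vars_below_def by (auto split: if_splits)
    qed
  qed
  then show ?thesis using c0(1) F unfolding P(2)
    by (intro exI[of _ F] exI[of _ K] exI[of _ "c0 * c0"] exI[of _ R] exI[of _ c0]) auto
qed

lemma of_nat_dvd_mpolyI:
  fixes P :: "int mpoly"
  assumes "\<And>m. int p dvd mcoeff P m"
  shows "of_nat p dvd P"
proof -
  have "P = of_nat p * Poly_Mapping.map (\<lambda>x. x div int p) P"
    by (rule poly_mapping_eqI) (use assms in \<open>auto simp: mcoeff_of_nat_mult map.rep_eq when_def\<close>)
  then show ?thesis by (rule dvdI)
qed

text \<open>
  The reduction of \<open>f\<close> and the integral multiple \<open>F = c0 f\<close> differ modulo \<open>p\<close> by the unit \<open>c0\<close>, which does not affect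
  membership of powers in an ideal.
\<close>

lemma reduce_mod_power_in_var_power_ideal_iff:
  assumes p: "prime p" "\<not> int p dvd c0" and f: "f \<in> carrier (mpoly_ring QQ n)"
    and F: "\<And>m. of_int (mcoeff F m) = of_int c0 * f m" and q: "q > 0"
  shows "reduce_mod p f [^]\<^bsub>mpoly_ring (FF p) n\<^esub> N \<in> var_power_ideal (FF p) n q \<longleftrightarrow> F ^ N \<in> frob_ideal p q"
proof -
  interpret Q: coeff_hom QQ id id by (rule rat_coeff_hom)
  interpret coeff_hom "FF p" "\<lambda>z. z mod int p" "\<lambda>z. z" by (rule residue_coeff_hom[OF p(1)])
  have zero: "\<zero>\<^bsub>QQ\<^esub> = (0 :: rat)" "\<zero>\<^bsub>FF p\<^esub> = 0" by (simp_all add: ring_of_type_algebra_def residue_ring_def)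
  have rm0: "rat_mod p 0 = 0" by (simp add: rat_mod_def residue_ring_def)
  have "reduce_mod p f \<in> carrier (mpoly_ring (FF p) n)"
  proof -
    have "finite {m. f m \<noteq> 0}" and vars: "\<And>m. f m \<noteq> 0 \<Longrightarrow> set_mset m \<subseteq> {..<n}"
      using f unfolding Q.carrier_iff by (auto simp: zero)
    moreover have nz: "f m \<noteq> 0" if "reduce_mod p f m \<noteq> 0" for m
      using that rm0 by (auto simp: reduce_mod_def)
    ultimately have "finite {m. reduce_mod p f m \<noteq> 0}" by (elim rev_finite_subset) blast
    moreover have "reduce_mod p f m \<in> carrier (FF p)" for m
      using prime_gt_0_nat[OF p(1)] by (auto simp: reduce_mod_def rat_mod_def residue_ring_def split: prod.splits)
    ultimately show ?thesis unfolding carrier_iff zero using vars nz by blast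
  qed
  then obtain E where E: "vars_below n E" "to_mpoly E = reduce_mod p f" "mcoeff E = (\<lambda>z. z) \<circ> reduce_mod p f"
    by (rule to_mpoly_surj)
  have "int p dvd mcoeff (mterm {#} c0 * E - F) m" for m
  proof -
    have "[c0 * rat_mod p (f m) = mcoeff F m] (mod int p)" by (rule rat_mod_cong[OF p]) (simp add: F)
    then show ?thesis by (simp add: lookup_minus mcoeff_term_mult E(3) reduce_mod_def cong_iff_dvd_diff)
  qed
  then have "of_nat p dvd mterm {#} c0 * E - F" by (rule of_nat_dvd_mpolyI)
  then have "of_nat p dvd (mterm {#} c0 * E) ^ N - F ^ N" by (metis dvd_mult2 power_diff_sumr2)
  then have "F ^ N \<in> frob_ideal p q \<longleftrightarrow> (mterm {#} c0 * E) ^ N \<in> frob_ideal p q" using frob_ideal_cong by blast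
  also have "(mterm {#} c0 * E) ^ N = mterm {#} (c0 ^ N) * E ^ N" by (simp add: power_mult_distrib mterm_power)
  also have "\<dots> \<in> frob_ideal p q \<longleftrightarrow> E ^ N \<in> frob_ideal p q"
  proof -
    have "\<not> int p dvd c0 ^ N" using p by (auto dest: prime_dvd_power_int[rotated])
    then show ?thesis using frob_ideal_cancel_const[OF p(1)] frob_ideal_mult' by blast
  qed
  also have "\<dots> \<longleftrightarrow> to_mpoly (E ^ N) \<in> var_power_ideal (FF p) n q"
    using to_mpoly_mod_in_var_power_ideal_iff[OF p(1) vars_below_power[OF E(1)] q] by blast
  also have "to_mpoly (E ^ N) = reduce_mod p f [^]\<^bsub>mpoly_ring (FF p) n\<^esub> N" by (simp add: to_mpoly_power[where n = n] E(2))
  finally show ?thesis by blast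
qed

section \<open>Thresholds of quasi-homogeneous isolated singularities\<close>

lemma eventually_not_dvd:
  assumes "c \<noteq> 0"
  shows "\<forall>\<^sub>F p in at_top. \<not> int p dvd c"
  using eventually_gt_at_top[of "nat \<bar>c\<bar>"]
proof eventually_elim
  case (elim p)
  then show ?case using assms zdvd_not_zless[of "\<bar>c\<bar>" "int p"] by auto
qed

text \<open>
  Powers of a single integral polynomial \<open>F\<close> decide the exponents \<open>frob_nu\<close> at all large primes, so both the
  general estimates and calculations with a concrete \<open>f\<close> can be made over the integers.
\<close>

lemma frob_nu_sequence:
  assumes n: "1 \<le> n" and hi: "homogeneous_isolated n f"
    and w: "\<forall>i<n. w i > 0" and deg: "\<forall>m. f m \<noteq> 0 \<longrightarrow> (\<Sum>i<n. w i * count m i) = d"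
  shows "\<exists>F c0. d > 0 \<and> (\<forall>m. of_int (mcoeff F m) = of_int c0 * f m) \<and> hom_poly n w d F \<and>
    (\<forall>\<^sub>F p in at_top. prime p \<longrightarrow>
       nu_sequence p n (real (\<Sum>i<n. w i) / real d) (frob_nu n p (reduce_mod p f)) \<and>
       (\<forall>e N. F ^ N \<in> frob_ideal p (p ^ e) \<longleftrightarrow> frob_nu n p (reduce_mod p f) e < N))"
proof -
  obtain F K c R c0 where q: "quasi_homogeneous n w d F K c R" and c: "c \<noteq> 0" "c0 \<noteq> 0"
    and F: "\<And>m. of_int (mcoeff F m) = of_int c0 * f m"
    using exists_integral_model[OF n hi w[rule_format] deg[rule_format]] by blast
  interpret quasi_homogeneous n w d F K c R by (rule q)
  have f: "f \<in> carrier (mpoly_ring QQ n)" using hi by (simp add: homogeneous_isolated_def)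
  have "\<forall>\<^sub>F p in at_top. prime p \<longrightarrow>
       nu_sequence p n (real (\<Sum>i<n. w i) / real d) (frob_nu n p (reduce_mod p f)) \<and>
       (\<forall>e N. F ^ N \<in> frob_ideal p (p ^ e) \<longleftrightarrow> frob_nu n p (reduce_mod p f) e < N)"
    using eventually_not_dvd[OF c(1)] eventually_not_dvd[OF c(2)]
  proof eventually_elim
    case (elim p)
    show ?case
    proof
      assume p: "prime p"
      have "frob_nu n p (reduce_mod p f) = nu p"
        unfolding frob_nu_def nu_def
        using reduce_mod_power_in_var_power_ideal_iff[OF p elim(2) f F] prime_gt_0_nat[OF p] by simp
      then show "nu_sequence p n (real (\<Sum>i<n. w i) / real d) (frob_nu n p (reduce_mod p f)) \<and>
         (\<forall>e N. F ^ N \<in> frob_ideal p (p ^ e) \<longleftrightarrow> frob_nu n p (reduce_mod p f) e < N)"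
        using nu_sequence_nu[OF p elim(1)] in_iff_gt_nu[OF p elim(1)] by simp
    qed
  qed
  moreover have "d > 0" using w_less[of 0] n_pos by simp
  ultimately show ?thesis using F F_hom by (intro exI[of _ F] exI[of _ c0]) simp
qed

lemma primes_at_top_neq_bot: "inf at_top (principal {p::nat. prime p}) \<noteq> bot"
proof
  assume "inf at_top (principal {p::nat. prime p}) = bot"
  then have "eventually (\<lambda>_. False) (inf at_top (principal {p::nat. prime p}))"
    by (simp only: eventually_bot)
  then have "eventually (\<lambda>p::nat. p \<in> {p. prime p} \<longrightarrow> False) at_top"
    by (simp only: eventually_inf_principal)
  then obtain B :: nat where B: "\<forall>p\<ge>B. p \<in> {p. prime p} \<longrightarrow> False"
    unfolding eventually_at_top_linorder by (rule exE)
  obtain p where "prime p" "p > B" using bigger_prime[of B] by (elim exE conjE)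
  then show False using B[rule_format, of p] by simp
qed

text \<open>
  For each fixed representation of \<open>min (\<Sum>w / d) 1\<close> as a fraction the gap estimates hold for all large primes. They
  force the thresholds to converge to that number, which identifies the log canonical threshold.
\<close>

theorem lct_and_gap:
  assumes n: "1 \<le> n" and hi: "homogeneous_isolated n f"
    and w: "\<forall>i<n. w i > 0" and deg: "\<forall>m. f m \<noteq> 0 \<longrightarrow> (\<Sum>i<n. w i * count m i) = d"
  shows "lct n f = min (real (\<Sum>i<n. w i) / real d) 1"
    and "\<lbrakk>0 < a; 0 < b; lct n f = real a / real b\<rbrakk> \<Longrightarrow>
      \<forall>\<^sub>F p in at_top. prime p \<longrightarrow>
             fpt n p (reduce_mod p f) = lct n f \<or>
             (1 / real b) / real p ^ ord b p \<le> lct n f - fpt n p (reduce_mod p f) \<and>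
             lct n f - fpt n p (reduce_mod p f) \<le> (real n - 1 - 1 / real b) / real p"
proof -
  define \<mu> where "\<mu> = real (\<Sum>i<n. w i) / real d"
  obtain F :: "int mpoly" and c0 :: int where d: "d > 0"
    and "\<forall>m. of_int (mcoeff F m) = of_int c0 * f m" "hom_poly n w d F"
    and nu: "\<forall>\<^sub>F p in at_top. prime p \<longrightarrow>
       nu_sequence p n \<mu> (frob_nu n p (reduce_mod p f)) \<and>
       (\<forall>e N. F ^ N \<in> frob_ideal p (p ^ e) \<longleftrightarrow> frob_nu n p (reduce_mod p f) e < N)"
    using frob_nu_sequence[OF n hi w deg, folded \<mu>_def] by (elim exE conjE)
  have gap: "\<forall>\<^sub>F p in at_top. prime p \<longrightarrow>
       fpt n p (reduce_mod p f) = min \<mu> 1 \<or>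
       (1 / real b) / real p ^ ord b p \<le> min \<mu> 1 - fpt n p (reduce_mod p f) \<and>
       min \<mu> 1 - fpt n p (reduce_mod p f) \<le> (real n - 1 - 1 / real b) / real p"
    if ab: "0 < a" "0 < b" "min \<mu> 1 = real a / real b" for a b
    using nu eventually_gt_at_top[of "n * b"] eventually_gt_at_top[of b]
  proof eventually_elim
    case (elim p)
    show ?case
    proof
      assume p: "prime p"
      then interpret nu_sequence p n \<mu> "frob_nu n p (reduce_mod p f)" using elim(1) by blast
      have thr: "fpt n p (reduce_mod p f) = threshold" by (simp add: fpt_def threshold_def)
      have "coprime b p"
        using p elim(3) ab(2) by (metis coprime_commute nat_dvd_not_less prime_imp_coprime)
      then show "fpt n p (reduce_mod p f) = min \<mu> 1 \<or>
       (1 / real b) / real p ^ ord b p \<le> min \<mu> 1 - fpt n p (reduce_mod p f) \<and>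
       min \<mu> 1 - fpt n p (reduce_mod p f) \<le> (real n - 1 - 1 / real b) / real p"
        using threshold_gap[of a b] ab elim(2) unfolding thr lam_def by auto
    qed
  qed
  have spos: "(\<Sum>i<n. w i) > 0" using n w by (intro sum_pos2[of _ 0]) auto
  have \<mu>ab: "min \<mu> 1 = real (min (\<Sum>i<n. w i) d) / real d"
  proof -
    have "min (real x / real d) 1 = real (min x d) / real d" for x
      using d by (simp add: min_def)
    then show ?thesis by (simp only: \<mu>_def)
  qed
  have num_pos: "0 < min (\<Sum>i<n. w i) d" using spos d by simp
  have "((\<lambda>p. fpt n p (reduce_mod p f)) \<longlongrightarrow> min \<mu> 1) (inf at_top (principal {p. prime p}))"
  proof (rule tendsto_sandwich)
    have *: "\<forall>\<^sub>F p in at_top. prime p \<longrightarrow> min \<mu> 1 - real n / real p \<le> fpt n p (reduce_mod p f) \<and> fpt n p (reduce_mod p f) \<le> min \<mu> 1"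
      using gap[OF num_pos d \<mu>ab] eventually_gt_at_top[of 0]
    proof eventually_elim
      case (elim p)
      show ?case
      proof
        assume "prime p"
        then have h: "fpt n p (reduce_mod p f) = min \<mu> 1 \<or>
           (1 / real d) / real p ^ ord d p \<le> min \<mu> 1 - fpt n p (reduce_mod p f) \<and>
           min \<mu> 1 - fpt n p (reduce_mod p f) \<le> (real n - 1 - 1 / real d) / real p" using elim(1) by blast
        have "(real n - 1 - 1 / real d) / real p \<le> real n / real p"
        proof (rule divide_right_mono)
          have "0 \<le> 1 / real d" by simp
          then show "real n - 1 - 1 / real d \<le> real n" by linarith
        qed simp
        moreover have "0 \<le> (1 / real d) / real p ^ ord d p" by simp
        moreover have "0 \<le> real n / real p" by simp
        ultimately show "min \<mu> 1 - real n / real p \<le> fpt n p (reduce_mod p f) \<and> fpt n p (reduce_mod p f) \<le> min \<mu> 1"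
          using h by linarith
      qed
    qed
    show "\<forall>\<^sub>F p in inf at_top (principal {p. prime p}). min \<mu> 1 - real n / real p \<le> fpt n p (reduce_mod p f)"
      unfolding eventually_inf_principal using * by eventually_elim auto
    show "\<forall>\<^sub>F p in inf at_top (principal {p. prime p}). fpt n p (reduce_mod p f) \<le> min \<mu> 1"
      unfolding eventually_inf_principal using * by eventually_elim auto
    have "(\<lambda>p. min \<mu> 1 - real n / real p) \<longlonglongrightarrow> min \<mu> 1 - 0"
      by (intro tendsto_diff tendsto_const lim_const_over_n)
    then show "((\<lambda>p. min \<mu> 1 - real n / real p) \<longlongrightarrow> min \<mu> 1) (inf at_top (principal {p. prime p}))"
      using tendsto_mono[OF inf_le1] by simp
  qed (rule tendsto_const)
  then show lct: "lct n f = min (real (\<Sum>i<n. w i) / real d) 1"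
    unfolding lct_def \<mu>_def[symmetric] by (intro tendsto_Lim primes_at_top_neq_bot)
  show "\<forall>\<^sub>F p in at_top. prime p \<longrightarrow>
             fpt n p (reduce_mod p f) = lct n f \<or>
             (1 / real b) / real p ^ ord b p \<le> lct n f - fpt n p (reduce_mod p f) \<and>
             lct n f - fpt n p (reduce_mod p f) \<le> (real n - 1 - 1 / real b) / real p"
    if "0 < a" "0 < b" "lct n f = real a / real b"
    using gap[of a b] that unfolding lct \<mu>_def[symmetric] by blast
qed

section \<open>The binary quartic \<open>x\<^sup>4 + y\<^sup>4\<close>\<close>

lemma product_mod_4_eq_1:
  fixes N :: nat
  assumes "N > 0" "\<And>p. prime p \<Longrightarrow> p dvd N \<Longrightarrow> p mod 4 = 1"
  shows "N mod 4 = 1"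
  using assms
proof (induction N rule: less_induct)
  case (less N)
  show ?case
  proof (cases "N = 1")
    case False
    then obtain p where p: "prime p" "p dvd N" using prime_factor_nat by blast
    then obtain M where M: "N = p * M" by (auto simp: dvd_def)
    have "M < N" "M > 0" using M less.prems(1) prime_gt_1_nat[OF p(1)] by auto
    then have "M mod 4 = 1" using less.IH less.prems(2) M by auto
    moreover have "p mod 4 = 1" using less.prems(2) p by blast
    ultimately show ?thesis unfolding M by (subst mod_mult_eq[symmetric]) simp
  qed simp
qed

text \<open>
  Euclid's argument with \<open>4 B! - 1\<close>: a number congruent to \<open>3\<close> modulo \<open>4\<close> has a prime factor
  that is not congruent to \<open>1\<close>.
\<close>

lemma infinite_primes_3_mod_4: "infinite {p::nat. prime p \<and> p mod 4 = 3}"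
  unfolding infinite_nat_iff_unbounded
proof
  fix B :: nat
  define N :: nat where "N = 4 * fact B - 1"
  have "(fact B :: nat) \<ge> 1" by (rule fact_ge_1)
  then have fact: "4 * fact B = N + 1" unfolding N_def by linarith
  then have "(N + 1) mod 4 = 0" by (metis mod_mult_self1_is_0)
  then have N: "N mod 4 = 3" by presburger
  then have "N > 0" by (cases N) auto
  then obtain p where p: "prime p" "p dvd N" "p mod 4 \<noteq> 1" using product_mod_4_eq_1[of N] N by fastforce
  have "odd N" using N by presburger
  then have "odd p" using p(2) dvd_trans by blast
  then have "p mod 4 = 3" using p(3) by presburger
  moreover have "B < p"
  proof (rule ccontr)
    assume "\<not> B < p"
    then have "p dvd 4 * fact B" using prime_gt_0_nat[OF p(1)] by (intro dvd_mult dvd_fact) auto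
    then have "p dvd N + 1" by (simp only: fact)
    then have "p dvd 1" using p(2) dvd_add_right_iff by blast
    then show False using p(1) by simp
  qed
  ultimately show "\<exists>p>B. p \<in> {p. prime p \<and> p mod 4 = 3}" using p(1) by blast
qed

definition binary_quartic :: "rat mpoly" where
  "binary_quartic = mterm (replicate_mset 4 0) 1 + mterm (replicate_mset 4 1) 1"

lemma sum_lessThan_2: "(\<Sum>i<2::nat. g i) = g 0 + g 1"
  by (simp add: numeral_2_eq_2)

lemma vars_below_binary_quartic: "vars_below 2 binary_quartic"
  unfolding binary_quartic_def by (intro vars_below_add vars_below_mterm) (auto split: if_splits)

lemma mcoeff_binary_quartic:
  "mcoeff binary_quartic m = (if m = replicate_mset 4 0 \<or> m = replicate_mset 4 1 then 1 else 0)"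
proof -
  have "replicate_mset 4 (0::nat) \<noteq> replicate_mset 4 1" by (simp add: multiset_eq_iff exI[of _ 0])
  then show ?thesis by (auto simp: binary_quartic_def lookup_add lookup_single when_def)
qed

lemma pdiff_binary_quartic:
  "pdiff 0 binary_quartic = mterm (replicate_mset 3 0) 4" "pdiff 1 binary_quartic = mterm (replicate_mset 3 1) 4"
proof -
  have 4: "replicate_mset 4 i = add_mset i (replicate_mset 3 i)" for i :: nat
    by (simp add: numeral_eq_Suc)
  show "pdiff 0 binary_quartic = mterm (replicate_mset 3 0) 4" "pdiff 1 binary_quartic = mterm (replicate_mset 3 1) 4"
    unfolding binary_quartic_def pdiff_add pdiff_mterm 4 by (simp_all add: numeral_eq_Suc)
qed

text \<open>
  Expresses \<open>(A + B)\<^sup>5\<close> through the cubes of \<open>A\<close> and \<open>B\<close>. With multiples of the two variables for \<open>A\<close> and \<open>B\<close>,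
  these cubes lie in the Jacobian ideal of \<open>x\<^sup>4 + y\<^sup>4\<close>, which is generated by \<open>4 x\<^sup>3\<close> and \<open>4 y\<^sup>3\<close>.
\<close>

lemma fifth_power_split:
  fixes A B :: "'a::comm_ring_1"
  shows "(A + B) ^ 5 = (A\<^sup>2 + 5 * A * B + 10 * B\<^sup>2) * A ^ 3 + (10 * A\<^sup>2 + 5 * A * B + B\<^sup>2) * B ^ 3"
  by (simp add: numeral_eq_Suc algebra_simps)

lemma homogeneous_isolated_binary_quartic: "homogeneous_isolated 2 (mcoeff binary_quartic)"
proof -
  interpret coeff_hom QQ id id by (rule rat_coeff_hom)
  let ?M = "mpoly_ring QQ 2"
  interpret M: cring ?M by (rule cring_M)
  have zero: "\<zero>\<^bsub>QQ\<^esub> = (0 :: rat)" by (simp add: ring_of_type_algebra_def)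
  have im: "to_mpoly P = mcoeff P" for P by (simp add: to_mpoly_def)
  note vb = vars_below_binary_quartic
  note jac = jacobian_ideal_eq[OF vb, unfolded im]
  have carrier: "mcoeff binary_quartic \<in> carrier ?M" using to_mpoly_closed[OF vb] by (simp add: im)
  have nonzero: "mcoeff binary_quartic \<noteq> \<zero>\<^bsub>?M\<^esub>"
  proof
    assume "mcoeff binary_quartic = \<zero>\<^bsub>?M\<^esub>"
    then have "mcoeff binary_quartic (replicate_mset 4 0) = mcoeff 0 (replicate_mset 4 0)"
      using to_mpoly_zero[where n = 2] by (simp add: im)
    then show False by (simp add: mcoeff_binary_quartic)
  qed
  have grading: "homogeneous_some_grading QQ 2 (mcoeff binary_quartic)"
    unfolding homogeneous_some_grading_def zero mcoeff_binary_quartic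
    by (intro exI[of _ "\<lambda>_. 1"] conjI exI[of _ 4]) (auto simp: sum_lessThan_2)
  have max_iff: "mcoeff Q \<in> maximal_ideal_origin QQ 2 \<longleftrightarrow> mcoeff Q {#} = 0" if "vars_below 2 Q" for Q :: "rat mpoly"
    using to_mpoly_in_maximal_ideal_iff[OF that] by (simp add: im zero)
  have max_eq: "mcoeff Q {#} = 0 \<Longrightarrow> vars_below 2 Q \<Longrightarrow>
      \<exists>r0 r1. vars_below 2 r0 \<and> vars_below 2 r1 \<and> Q = r0 * mterm {#0#} 1 + r1 * mterm {#1#} 1" for Q :: "rat mpoly"
  proof -
    assume Q: "mcoeff Q {#} = 0" "vars_below 2 Q"
    have "below 1 m \<longleftrightarrow> m = {#}" for m by (auto simp: below_def multiset_eq_iff)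
    then have "to_mpoly Q \<in> var_power_ideal QQ 2 1"
      using to_mpoly_in_var_power_ideal_iff[OF Q(2), of 1] Q(1) by (simp add: zero)
    then obtain r where r: "mcoeff Q = mcoeff (\<Sum>j<2. r j * mterm (replicate_mset 1 j) 1)" "\<forall>j<2. vars_below 2 (r j)"
      unfolding var_power_ideal_eq im by blast
    then have "Q = (\<Sum>j<2. r j * mterm (replicate_mset 1 j) 1)" by (intro poly_mapping_eqI) simp
    then show ?thesis using r(2) by (intro exI[of _ "r 0"] exI[of _ "r 1"]) (simp add: sum_lessThan_2)
  qed
  have "ideal_radical ?M (jacobian_ideal QQ 2 (mcoeff binary_quartic)) = maximal_ideal_origin QQ 2" (is "?rad = ?max")
  proof (intro equalityI subsetI)
    fix g assume "g \<in> ?rad"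
    then obtain k :: nat where g: "g \<in> carrier ?M" "g [^]\<^bsub>?M\<^esub> k \<in> jacobian_ideal QQ 2 (mcoeff binary_quartic)"
      unfolding ideal_radical_def by blast
    obtain Q where Q: "vars_below 2 Q" "to_mpoly Q = g" using g(1) by (rule to_mpoly_surj)
    have "to_mpoly (Q ^ k) \<in> jacobian_ideal QQ 2 (mcoeff binary_quartic)"
      using g(2) by (simp only: to_mpoly_power[where n = 2] Q(2))
    then have "mcoeff (Q ^ k) \<in> jacobian_ideal QQ 2 (mcoeff binary_quartic)" unfolding im .
    then obtain r where "mcoeff (Q ^ k) = mcoeff (\<Sum>j<2. r j * pdiff j binary_quartic)" unfolding jac by blast
    then have "mcoeff (Q ^ k) {#} = 0"
      by (simp add: sum_lessThan_2 pdiff_binary_quartic[unfolded One_nat_def] lookup_add mult.commute[of "r _"] mcoeff_term_mult)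
    moreover have "mcoeff (Q ^ k) {#} = mcoeff Q {#} ^ k" by (induction k) (auto simp: mcoeff_mult)
    ultimately have "mcoeff Q {#} = 0" by simp
    then show "g \<in> ?max" using max_iff[OF Q(1)] Q(2) by (simp add: im)
  next
    fix g assume g: "g \<in> ?max"
    have "indexed_var ` {..<2} \<subseteq> carrier ?M"
      by (auto simp flip: to_mpoly_var intro!: to_mpoly_closed vars_below_mterm)
    then interpret max: ideal ?max ?M unfolding maximal_ideal_origin_def by (rule M.genideal_ideal)
    have gM: "g \<in> carrier ?M" using g by (rule max.Icarr)
    obtain Q where Q: "vars_below 2 Q" "to_mpoly Q = g" using gM by (rule to_mpoly_surj)
    have "mcoeff Q {#} = 0" using g max_iff[OF Q(1)] Q(2) by (simp add: im)
    then obtain r0 r1 where r: "vars_below 2 r0" "vars_below 2 r1" "Q = r0 * mterm {#0#} 1 + r1 * mterm {#1#} 1"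
      using max_eq Q(1) by blast
    let ?A = "r0 * mterm {#0#} 1" and ?B = "r1 * mterm {#1#} 1"
    define s0 where "s0 = (?A\<^sup>2 + 5 * ?A * ?B + 10 * ?B\<^sup>2) * r0 ^ 3 * mterm {#} (1/4)"
    define s1 where "s1 = (10 * ?A\<^sup>2 + 5 * ?A * ?B + ?B\<^sup>2) * r1 ^ 3 * mterm {#} (1/4)"
    have cube: "(r * mterm {#i#} 1) ^ 3 = r ^ 3 * mterm {#} (1/4) * mterm (replicate_mset 3 i) 4" for r :: "rat mpoly" and i
      by (simp add: power_mult_distrib mterm_power mult_single mult.assoc)
    have "Q ^ 5 = s0 * mterm (replicate_mset 3 0) 4 + s1 * mterm (replicate_mset 3 1) 4"
      unfolding r(3) fifth_power_split cube s0_def s1_def by (simp only: mult.assoc)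
    then have "Q ^ 5 = (\<Sum>j<2. (if j = 0 then s0 else s1) * pdiff j binary_quartic)"
      by (simp add: sum_lessThan_2 pdiff_binary_quartic[unfolded One_nat_def])
    moreover have "vars_below 2 s0" "vars_below 2 s1"
      unfolding s0_def s1_def
      by (auto intro!: vars_below_mult vars_below_add vars_below_power vars_below_mterm r simp flip: single_numeral)
    ultimately have "mcoeff (Q ^ 5) \<in> jacobian_ideal QQ 2 (mcoeff binary_quartic)"
      unfolding jac by (intro CollectI exI[of _ "\<lambda>j. if j = 0 then s0 else s1"]) auto
    then have "to_mpoly (Q ^ 5) \<in> jacobian_ideal QQ 2 (mcoeff binary_quartic)" unfolding im .
    then have "g [^]\<^bsub>?M\<^esub> (5::nat) \<in> jacobian_ideal QQ 2 (mcoeff binary_quartic)"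
      by (simp only: to_mpoly_power[where n = 2] Q(2))
    then show "g \<in> ?rad" unfolding ideal_radical_def using gM by blast
  qed
  then show ?thesis
    using carrier nonzero grading unfolding homogeneous_isolated_def isolated_singularity_origin_def by blast
qed

text \<open>
  All exponents in a power of \<open>x\<^sup>4 + y\<^sup>4\<close> are multiples of \<open>4\<close>. The power with exponent \<open>(p - 1) / 2\<close> has degree
  \<open>2 (p - 1)\<close>, so its only possible monomial outside \<open>\<mm>\<^bsup>[p]\<^esup>\<close> is \<open>(xy)\<^bsup>p-1\<^esup>\<close>, and this is excluded when
  \<open>p \<equiv> 3\<close> modulo \<open>4\<close>. Hence \<open>2 (\<nu>(1) + 1) \<le> p - 1\<close>, which keeps the threshold below \<open>1/2\<close>.
\<close>

lemma lct_binary_quartic: "lct 2 (mcoeff binary_quartic) = 1 / 2"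
  and fpt_binary_quartic: "\<forall>\<^sub>F p in at_top. prime p \<longrightarrow> p mod 4 = 3 \<longrightarrow> fpt 2 p (reduce_mod p (mcoeff binary_quartic)) < 1 / 2"
proof -
  let ?f = "mcoeff binary_quartic" and ?w = "\<lambda>_::nat. 1::nat"
  have w: "\<forall>i<2. ?w i > 0" by simp
  have deg: "\<forall>m. ?f m \<noteq> 0 \<longrightarrow> (\<Sum>i<2. ?w i * count m i) = 4"
    by (auto simp: mcoeff_binary_quartic sum_lessThan_2)
  note hi = homogeneous_isolated_binary_quartic
  show "lct 2 ?f = 1 / 2"
    using lct_and_gap(1)[OF _ hi w deg] by simp
  have two: "1 \<le> (2::nat)" by simp
  obtain F :: "int mpoly" and c0 :: int where "(4::nat) > 0"
    and F: "\<forall>m. of_int (mcoeff F m) = of_int c0 * ?f m" "hom_poly 2 ?w 4 F"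
    and nu: "\<forall>\<^sub>F p in at_top. prime p \<longrightarrow>
       nu_sequence p 2 (real (\<Sum>i<2. ?w i) / real 4) (frob_nu 2 p (reduce_mod p ?f)) \<and>
       (\<forall>e N. F ^ N \<in> frob_ideal p (p ^ e) \<longleftrightarrow> frob_nu 2 p (reduce_mod p ?f) e < N)"
    using frob_nu_sequence[OF two hi w deg] by (elim exE conjE)
  have F4: "4 dvd count m i" if "mcoeff F m \<noteq> 0" for m i
  proof -
    have "?f m \<noteq> 0" using that F(1)[rule_format, of m] by auto
    then show ?thesis by (auto simp: mcoeff_binary_quartic split: if_splits)
  qed
  have FN4: "mcoeff (F ^ N) m \<noteq> 0 \<Longrightarrow> 4 dvd count m i" for N m i
  proof (induction N arbitrary: m)
    case 0
    then show ?case by (auto simp: lookup_one when_def split: if_splits)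
  next
    case (Suc N)
    then obtain u v where "m = u + v" "mcoeff F u \<noteq> 0" "mcoeff (F ^ N) v \<noteq> 0"
      by (metis mcoeff_mult_nonzeroE power_Suc)
    then show ?case using F4 Suc.IH by simp
  qed
  show "\<forall>\<^sub>F p in at_top. prime p \<longrightarrow> p mod 4 = 3 \<longrightarrow> fpt 2 p (reduce_mod p ?f) < 1 / 2"
    using nu
  proof eventually_elim
    case (elim p)
    show ?case
    proof (intro impI)
      assume p: "prime p" "p mod 4 = 3"
      then interpret nu_sequence p 2 "real (\<Sum>i<2. ?w i) / real 4" "frob_nu 2 p (reduce_mod p ?f)"
        using elim by blast
      define N where "N = (p - 1) div 2"
      have N: "2 * N = p - 1" unfolding N_def using p(2) by presburger
      have "mcoeff (F ^ N) m = 0" if m: "below p m" for m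
      proof (rule ccontr)
        assume nz: "mcoeff (F ^ N) m \<noteq> 0"
        have "set_mset m \<subseteq> {..<2} \<and> wdeg ?w m = N * 4"
          using hom_poly_power[OF F(2), of N] nz unfolding hom_poly_def by blast
        then have "count m 0 + count m 1 = N * 4" using wdeg_eq_sum[of m 2 ?w] by (simp add: sum_lessThan_2)
        moreover have "count m 0 < p" "count m 1 < p" using m by (auto simp: below_def)
        ultimately have "count m 0 = p - 1" using N by linarith
        then have "4 dvd p - 1" using FN4[OF nz, of 0] by simp
        then show False using p(2) by presburger
      qed
      then have "F ^ N \<in> frob_ideal p (p ^ 1)" by (simp add: frob_ideal_def)
      then have "frob_nu 2 p (reduce_mod p ?f) 1 < N" using elim p(1) by blast
      moreover define v where "v = frob_nu 2 p (reduce_mod p ?f) 1"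
      ultimately have "v < N" by simp
      then have "2 * (v + 1) < p" using N p_gt_1 by presburger
      then have "real (2 * (v + 1)) < real p" by (simp only: of_nat_less_iff)
      then have "2 * (real v + 1) < real p" by simp
      then have "(real v + 1) / real (p ^ 1) < 1 / 2"
        using p_gt_1 by (simp add: divide_less_eq mult.commute)
      then have "(real (frob_nu 2 p (reduce_mod p ?f) 1) + 1) / real (p ^ 1) < 1 / 2"
        unfolding v_def .
      moreover have "fpt 2 p (reduce_mod p ?f) = threshold" by (simp add: fpt_def threshold_def)
      ultimately show "fpt 2 p (reduce_mod p ?f) < 1 / 2" using threshold_le_upper[of 1] by linarith
    qed
  qed
qed

lemma ord_2_odd:
  fixes p :: nat
  assumes "odd p"
  shows "ord 2 p = 1"
proof -
  have "[p = 1] (mod 2)" using assms by (simp add: cong_def odd_iff_mod_2_eq_one)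
  then have "ord 2 p dvd 1" using ord_divides[of p 1 2] by simp
  then show ?thesis by simp
qed

text \<open>
  For \<open>n = 2\<close>, \<open>b = 2\<close> and odd \<open>p\<close> the lower and the upper bound coincide, so as soon as the threshold differs
  from \<open>1/2\<close> the gap is determined.
\<close>

lemma binary_quartic_bounds_sharp:
  "infinite {p. prime p \<and> odd p \<and> fpt 2 p (reduce_mod p (mcoeff binary_quartic)) \<noteq> lct 2 (mcoeff binary_quartic) \<and>
     lct 2 (mcoeff binary_quartic) - fpt 2 p (reduce_mod p (mcoeff binary_quartic)) = 1 / (2 * real p)}"
    (is "infinite ?S")
proof -
  let ?f = "mcoeff binary_quartic" and ?w = "\<lambda>_::nat. 1::nat"
  have w: "\<forall>i<2. ?w i > 0" by simp
  have deg: "\<forall>m. ?f m \<noteq> 0 \<longrightarrow> (\<Sum>i<2. ?w i * count m i) = 4"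
    by (auto simp: mcoeff_binary_quartic sum_lessThan_2)
  have gap: "\<forall>\<^sub>F p in at_top. prime p \<longrightarrow> fpt 2 p (reduce_mod p ?f) = lct 2 ?f \<or>
       (1 / real 2) / real p ^ ord 2 p \<le> lct 2 ?f - fpt 2 p (reduce_mod p ?f) \<and>
       lct 2 ?f - fpt 2 p (reduce_mod p ?f) \<le> (real 2 - 1 - 1 / real 2) / real p"
    by (rule lct_and_gap(2)[OF _ homogeneous_isolated_binary_quartic w deg, of 1])
       (auto simp: lct_binary_quartic)
  have "\<forall>\<^sub>F p in at_top. prime p \<and> p mod 4 = 3 \<longrightarrow> p \<in> ?S"
    using fpt_binary_quartic gap
  proof eventually_elim
    case (elim p)
    show ?case
    proof
      assume p: "prime p \<and> p mod 4 = 3"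
      then have "p mod 4 = 3" by (rule conjunct2)
      then have "odd p" by presburger
      then have "ord 2 p = 1" by (rule ord_2_odd)
      then show "p \<in> ?S" using elim p lct_binary_quartic by auto
    qed
  qed
  then obtain B where B: "\<And>p. p \<ge> B \<Longrightarrow> prime p \<and> p mod 4 = 3 \<Longrightarrow> p \<in> ?S"
    unfolding eventually_at_top_linorder by blast
  have "{p. prime p \<and> p mod 4 = 3} \<subseteq> ?S \<union> {..<B}" using B by (auto simp: not_le[symmetric])
  then show "infinite ?S"
    using infinite_primes_3_mod_4 by (meson finite_UnI finite_lessThan finite_subset)
qed

section \<open>The bounds and their sharpness\<close>

theorem theoremB:
  shows
    "(\<forall>(n::nat) (f :: nat multiset \<Rightarrow> rat). 1 \<le> n \<and> homogeneous_isolated n f \<longrightarrow>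
        (\<exists>(a::nat) (b::nat). 0 < b \<and> coprime a b \<and> lct n f = real a / real b \<and>
          (\<forall>\<^sub>F p in at_top. Factorial_Ring.prime p \<longrightarrow>
             fpt n p (reduce_mod p f) = lct n f \<or>
             (1 / real b) / real p ^ ord b p \<le> lct n f - fpt n p (reduce_mod p f) \<and>
             lct n f - fpt n p (reduce_mod p f) \<le> (real n - 1 - 1 / real b) / real p)))
     \<and>
     (\<exists>(n::nat) (f :: nat multiset \<Rightarrow> rat) (a::nat) (b::nat).
        1 \<le> n \<and> homogeneous_isolated n f \<and>
        0 < b \<and> coprime a b \<and> lct n f = real a / real b \<and>
        infinite {p. Factorial_Ring.prime p \<and> fpt n p (reduce_mod p f) \<noteq> lct n f \<and>
          lct n f - fpt n p (reduce_mod p f) = (1 / real b) / real p ^ ord b p})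
     \<and>
     (\<exists>(n::nat) (f :: nat multiset \<Rightarrow> rat) (a::nat) (b::nat).
        1 \<le> n \<and> homogeneous_isolated n f \<and>
        0 < b \<and> coprime a b \<and> lct n f = real a / real b \<and>
        infinite {p. Factorial_Ring.prime p \<and> fpt n p (reduce_mod p f) \<noteq> lct n f \<and>
          lct n f - fpt n p (reduce_mod p f) = (real n - 1 - 1 / real b) / real p})"
proof (intro conjI allI impI)
  fix n :: nat and f :: "nat multiset \<Rightarrow> rat"
  assume h: "1 \<le> n \<and> homogeneous_isolated n f"
  then have n: "1 \<le> n" and hi: "homogeneous_isolated n f" by blast+
  then obtain w :: "nat \<Rightarrow> nat" and d where w: "\<forall>i<n. w i > 0"
    and deg: "\<forall>m. f m \<noteq> 0 \<longrightarrow> (\<Sum>i<n. w i * count m i) = d"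
    unfolding homogeneous_isolated_def homogeneous_some_grading_def
    by (auto simp: ring_of_type_algebra_def)
  let ?x = "min (\<Sum>i<n. w i) d"
  have d: "d > 0" using frob_nu_sequence[OF n hi w deg] by blast
  have "(\<Sum>i<n. w i) > 0" using n w by (intro sum_pos2[of _ 0]) auto
  then have x: "?x > 0" using d by simp
  have "min (real x / real d) 1 = real (min x d) / real d" for x
    using d by (simp add: min_def)
  then have "lct n f = real ?x / real d" unfolding lct_and_gap(1)[OF n hi w deg] .
  moreover obtain a b where ab: "?x = a * gcd ?x d" "d = b * gcd ?x d" "coprime a b"
    using gcd_coprime_exists[of ?x d] d by auto
  moreover have g: "gcd ?x d > 0" using d by simp
  ultimately have lct: "lct n f = real a / real b"
    by (metis mult_divide_mult_cancel_right of_nat_0_less_iff of_nat_mult order_less_irrefl)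
  have "0 < a" "0 < b" using ab x d by (metis gr0I mult_0)+
  then show "\<exists>(a::nat) (b::nat). 0 < b \<and> coprime a b \<and> lct n f = real a / real b \<and>
          (\<forall>\<^sub>F p in at_top. prime p \<longrightarrow>
             fpt n p (reduce_mod p f) = lct n f \<or>
             (1 / real b) / real p ^ ord b p \<le> lct n f - fpt n p (reduce_mod p f) \<and>
             lct n f - fpt n p (reduce_mod p f) \<le> (real n - 1 - 1 / real b) / real p)"
    using lct_and_gap(2)[OF n hi w deg _ _ lct] ab(3) lct by blast
next
  let ?f = "mcoeff binary_quartic"
  have basic: "1 \<le> (2::nat)" "homogeneous_isolated 2 ?f" "0 < (2::nat)" "coprime (1::nat) 2"
    "lct 2 ?f = real 1 / real 2"
    using homogeneous_isolated_binary_quartic lct_binary_quartic by simp_all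
  have "infinite {p. prime p \<and> fpt 2 p (reduce_mod p ?f) \<noteq> lct 2 ?f \<and>
          lct 2 ?f - fpt 2 p (reduce_mod p ?f) = (1 / real 2) / real p ^ ord 2 p}"
    by (rule infinite_super[OF _ binary_quartic_bounds_sharp]) (auto simp: ord_2_odd)
  then show "\<exists>(n::nat) (f :: nat multiset \<Rightarrow> rat) (a::nat) (b::nat).
        1 \<le> n \<and> homogeneous_isolated n f \<and>
        0 < b \<and> coprime a b \<and> lct n f = real a / real b \<and>
        infinite {p. prime p \<and> fpt n p (reduce_mod p f) \<noteq> lct n f \<and>
          lct n f - fpt n p (reduce_mod p f) = (1 / real b) / real p ^ ord b p}"
    using basic by blast
  have "infinite {p. prime p \<and> fpt 2 p (reduce_mod p ?f) \<noteq> lct 2 ?f \<and>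
          lct 2 ?f - fpt 2 p (reduce_mod p ?f) = (real 2 - 1 - 1 / real 2) / real p}"
    by (rule infinite_super[OF _ binary_quartic_bounds_sharp]) (auto)
  then show "\<exists>(n::nat) (f :: nat multiset \<Rightarrow> rat) (a::nat) (b::nat).
        1 \<le> n \<and> homogeneous_isolated n f \<and>
        0 < b \<and> coprime a b \<and> lct n f = real a / real b \<and>
        infinite {p. prime p \<and> fpt n p (reduce_mod p f) \<noteq> lct n f \<and>
          lct n f - fpt n p (reduce_mod p f) = (real n - 1 - 1 / real b) / real p}"
    using basic by blast
qed

end
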